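(* Let $\vec G=(V,E)$ be a connected directed graph on a linearly ordered edge set $E$ which is bipolar with respect to $p=\min(E)$, and let $r$ be the number of edges of a spanning tree of $G$. Run the following algorithm. (1) Let $p<f_2<\dots<f_r$ be the lexicographically smallest spanning tree of $G$ (with respect to the order on $E$), and initialize the current optimizable digraph as $\vec G$ itself with infinity edge $p$, ground set $E$ and objective set $F=\{f_2<\dots<f_r\}$. (2) For $i=2,\dots,r$: (2.1) let $C_{\mathrm{opt}}$ be the optimal cocycle of the current optimizable digraph $\vec G$ (with infinity edge $p$, ground set $E$, objective set $F$); (2.2) let $t_i=\min(E\setminus C_{\mathrm{opt}})$; (2.3) let $p'=t_i$; (2.4) let $E'=E\setminus C_{\mathrm{opt}}$; (2.5) if $p'\in F$ let $F'=F\setminus\{p'\}$; if $p'\notin F$ let $F'=F\setminus\{\max(F\cap C_G(F\cup\{p\};p'))\}$, where $C_G(F\cup\{p\};p')$ is the fundamental cycle of $p'$ with respect to the spanning tree $F\cup\{p\}$ of the current graph $G$; (2.6) let $\vec G'$ be the digraph obtained from the current $\vec G$ by deleting all edges not in $E'\cup F'\cup\{p\}$ and then contracting $p$, regarded as an optimizable digraph with infinity edge $p'$, ground set $E'$ and objective set $F'$ (ordered by the order of the original $E$); (2.7) replace $\vec G,p,E,F$ by $\vec G',p',E',F'$. (3) Output $\{p,t_2,\dots,t_r\}$. Then the output $\{p<t_2<\dots<t_r\}$ is exactly the fully optimal spanning tree $\alpha(\vec G)$ of $\vec G$.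
   Context: Graphs are finite and connected, loops and multiple edges allowed; cycles and cocycles (inclusion-minimal nonempty edge cuts) are regarded as edge subsets. For a spanning tree $T$ and $t\in T$, the fundamental cocycle $C^*(T;t)$ is the unique cocycle contained in $(E\setminus T)\cup\{t\}$; for $e\notin T$ the fundamental cycle $C(T;e)$ is the unique cycle contained in $T\cup\{e\}$. In a digraph, a cycle gives two opposite signed cycles (fix a traversal direction; edges traversed forward are positive, backward negative), and a cocycle, being the set of edges between the sides of a vertex bipartition $(X,V\setminus X)$, gives two opposite signed cocycles (edges from $X$ to $V\setminus X$ positive, the others negative). A fundamental cycle $C(T;e)$ (resp. cocycle $C^*(T;t)$) is signed so that $e$ (resp. $t$) is positive. A directed cocycle is one whose edges all have the same sign. A digraph with edge set $E$ is bipolar with respect to $p\in E$ if it is acyclic and has a unique source and a unique sink, which are the two endpoints of $p$ (a digraph consisting of a single isthmus edge $p$ is bipolar w.r.t. $p$). For $\vec G$ on a linearly ordered edge set $E$, bipolar w.r.t. $p=\min(E)$, its fully optimal spanning tree $\alpha(\vec G)$ is the unique spanning tree $T$ of $G$ such that for every $b\in T\setminus\{p\}$, $b$ and $\min(C^*(T;b))$ have opposite signs in $C^*(T;b)$, and for every $e\in E\setminus T$, $e$ and $\min(C(T;e))$ have opposite signs in $C(T;e)$ (existence and uniqueness of such $T$ is a known theorem). An optimizable digraph is a connected digraph with edge set $E\cup F$ (possibly $E\cap F\neq\emptyset$), together with an edge $p\in E\setminus F$ (infinity edge), a ground set $E$ such that the subdigraph $\vec G(E)$ restricted to the edges of $E$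 is acyclic, and a linearly ordered objective set $F$ such that $F\cup\{p\}$ is a spanning tree of $G$. Signed cocycles of $\vec G$ containing $p$ are linearly ordered as follows: for distinct such $C,D$, let $f$ be the smallest element of $F$ that either lies in the symmetric difference $C\triangle D$ or lies in $C\cap D$ with opposite signs in $C$ and $D$; set $C>D$ if $f$ is positive in $C$ or negative in $D$, and $D>C$ otherwise. (Equivalently, writing $F=\{f_2<\dots<f_r\}$, give $f_i$ weight $2^{r-i}$ if positive and $-2^{r-i}$ if negative in a signed cocycle, elements outside $F$ weight $0$, and compare total weights.) The optimal cocycle is the maximum, in this order, among signed cocycles $C$ of $\vec G$ containing $p$ with $p$ positive and with all elements of $C\cap E$ positive (i.e. inducing a directed cocycle of $\vec G(E)$). *)

theory Defs
  imports Main "Graph_Theory.Digraph"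
begin

text \<open>Digraphs are pre_digraph records (verts, arcs, tail, head) from the AFP entry
Graph_Theory: finite multidigraphs, loops and parallel arcs allowed.
Signed edge sets are pairs (positive part, negative part).\<close>

type_synonym 'e signed = "'e set \<times> 'e set"

definition supp :: "'e signed \<Rightarrow> 'e set" where
  "supp C = fst C \<union> snd C"

definition opposite_signs :: "'e signed \<Rightarrow> 'e \<Rightarrow> 'e \<Rightarrow> bool" where
  "opposite_signs C a b \<longleftrightarrow> (a \<in> fst C \<and> b \<in> snd C) \<or> (a \<in> snd C \<and> b \<in> fst C)"

subsection \<open>Connectivity, cycles, spanning trees\<close>

text \<open>Undirected connectivity of the vertex set using only the arcs in S.\<close>
definition ulink :: "('v,'e) pre_digraph \<Rightarrow> 'e set \<Rightarrow> ('v \<times> 'v) set" where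
  "ulink G S = {(tail G e, head G e) | e. e \<in> S \<inter> arcs G} \<union> {(head G e, tail G e) | e. e \<in> S \<inter> arcs G}"

definition connected_by :: "('v,'e) pre_digraph \<Rightarrow> 'e set \<Rightarrow> bool" where
  "connected_by G S \<longleftrightarrow> (\<forall>u\<in>verts G. \<forall>v\<in>verts G. (u, v) \<in> (ulink G S)\<^sup>*)"

definition connected_digraph :: "('v,'e) pre_digraph \<Rightarrow> bool" where
  "connected_digraph G \<longleftrightarrow> verts G \<noteq> {} \<and> connected_by G (arcs G)"

text \<open>A signed cycle: given by a closed walk v_0 e_0 v_1 ... v_(n-1) e_(n-1) v_0 with
distinct vertices and distinct edges; each edge carries a flag saying whether it is
traversed forward (tail to head), in which case it is positive, or backward (negative).\<close>
definition signed_cycle :: "('v,'e) pre_digraph \<Rightarrow> 'e signed \<Rightarrow> bool" where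
  "signed_cycle G C \<longleftrightarrow>
     (\<exists>(vs :: 'v list) (es :: ('e \<times> bool) list).
        length vs \<ge> 1 \<and> length es = length vs \<and> distinct vs \<and> distinct (map fst es) \<and>
        (\<forall>i < length vs. fst (es ! i) \<in> arcs G \<and>
           (if snd (es ! i)
            then tail G (fst (es ! i)) = vs ! i \<and> head G (fst (es ! i)) = vs ! ((i + 1) mod length vs)
            else head G (fst (es ! i)) = vs ! i \<and> tail G (fst (es ! i)) = vs ! ((i + 1) mod length vs))) \<and>
        fst C = {fst (es ! i) | i. i < length vs \<and> snd (es ! i)} \<and>
        snd C = {fst (es ! i) | i. i < length vs \<and> \<not> snd (es ! i)})"

definition is_cycle :: "('v,'e) pre_digraph \<Rightarrow> 'e set \<Rightarrow> bool" where
  "is_cycle G D \<longleftrightarrow> (\<exists>C. signed_cycle G C \<and> supp C = D)"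

text \<open>Acyclic digraph: no directed cycle (signed cycle with all edges of the same sign).\<close>
definition acyclic_digraph :: "('v,'e) pre_digraph \<Rightarrow> bool" where
  "acyclic_digraph G \<longleftrightarrow> \<not> (\<exists>C. signed_cycle G C \<and> (fst C = {} \<or> snd C = {}))"

definition spanning_tree :: "('v,'e) pre_digraph \<Rightarrow> 'e set \<Rightarrow> bool" where
  "spanning_tree G T \<longleftrightarrow> T \<subseteq> arcs G \<and> connected_by G T \<and> \<not> (\<exists>D. is_cycle G D \<and> D \<subseteq> T)"

subsection \<open>Cocycles\<close>

definition out_cut :: "('v,'e) pre_digraph \<Rightarrow> 'v set \<Rightarrow> 'e set" where
  "out_cut G X = {e \<in> arcs G. tail G e \<in> X \<and> head G e \<notin> X}"

definition in_cut :: "('v,'e) pre_digraph \<Rightarrow> 'v set \<Rightarrow> 'e set" where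
  "in_cut G X = {e \<in> arcs G. head G e \<in> X \<and> tail G e \<notin> X}"

definition is_cut :: "('v,'e) pre_digraph \<Rightarrow> 'e set \<Rightarrow> bool" where
  "is_cut G D \<longleftrightarrow> (\<exists>X \<subseteq> verts G. D = out_cut G X \<union> in_cut G X)"

text \<open>Cocycle: inclusion-minimal nonempty edge cut.\<close>
definition is_cocycle :: "('v,'e) pre_digraph \<Rightarrow> 'e set \<Rightarrow> bool" where
  "is_cocycle G D \<longleftrightarrow> is_cut G D \<and> D \<noteq> {} \<and> (\<forall>D'. is_cut G D' \<and> D' \<noteq> {} \<and> D' \<subseteq> D \<longrightarrow> D' = D)"

definition signed_cocycle :: "('v,'e) pre_digraph \<Rightarrow> 'e signed \<Rightarrow> bool" where
  "signed_cocycle G C \<longleftrightarrow>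
     (\<exists>X \<subseteq> verts G. fst C = out_cut G X \<and> snd C = in_cut G X) \<and> is_cocycle G (supp C)"

subsection \<open>Fundamental cycles and cocycles\<close>

definition fund_cocycle :: "('v,'e) pre_digraph \<Rightarrow> 'e set \<Rightarrow> 'e \<Rightarrow> 'e signed" where
  "fund_cocycle G T t = (THE C. signed_cocycle G C \<and> supp C \<subseteq> (arcs G - T) \<union> {t} \<and> t \<in> fst C)"

definition fund_cycle :: "('v,'e) pre_digraph \<Rightarrow> 'e set \<Rightarrow> 'e \<Rightarrow> 'e signed" where
  "fund_cycle G T e = (THE C. signed_cycle G C \<and> supp C \<subseteq> T \<union> {e} \<and> e \<in> fst C)"

subsection \<open>Bipolar digraphs and the fully optimal spanning tree\<close>

definition is_source :: "('v,'e) pre_digraph \<Rightarrow> 'v \<Rightarrow> bool" where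
  "is_source G v \<longleftrightarrow> v \<in> verts G \<and> in_arcs G v = {}"

definition is_sink :: "('v,'e) pre_digraph \<Rightarrow> 'v \<Rightarrow> bool" where
  "is_sink G v \<longleftrightarrow> v \<in> verts G \<and> out_arcs G v = {}"

definition bipolar :: "('v,'e) pre_digraph \<Rightarrow> 'e \<Rightarrow> bool" where
  "bipolar G p \<longleftrightarrow> p \<in> arcs G \<and> acyclic_digraph G \<and>
     (\<exists>s t. {v. is_source G v} = {s} \<and> {v. is_sink G v} = {t} \<and> {s, t} = {tail G p, head G p})"

definition fully_optimal :: "('v,'e::linorder) pre_digraph \<Rightarrow> 'e set \<Rightarrow> bool" where
  "fully_optimal G T \<longleftrightarrow> spanning_tree G T \<and>
     (\<forall>b \<in> T - {Min (arcs G)}. opposite_signs (fund_cocycle G T b) b (Min (supp (fund_cocycle G T b)))) \<and>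
     (\<forall>e \<in> arcs G - T. opposite_signs (fund_cycle G T e) e (Min (supp (fund_cycle G T e))))"

definition alpha :: "('v,'e::linorder) pre_digraph \<Rightarrow> 'e set" where
  "alpha G = (THE T. fully_optimal G T)"

subsection \<open>Optimizable digraphs and optimal cocycles\<close>

text \<open>C > D in the order on signed cocycles determined by the objective set F.\<close>
definition cocycle_greater :: "'e::linorder set \<Rightarrow> 'e signed \<Rightarrow> 'e signed \<Rightarrow> bool" where
  "cocycle_greater F C D \<longleftrightarrow>
     (let S = {f \<in> F. f \<in> (supp C - supp D) \<union> (supp D - supp C) \<or>
                      (f \<in> fst C \<inter> snd D) \<or> (f \<in> snd C \<inter> fst D)}
      in S \<noteq> {} \<and> (Min S \<in> fst C \<or> Min S \<in> snd D))"

definition opt_candidate :: "('v,'e) pre_digraph \<Rightarrow> 'e \<Rightarrow> 'e set \<Rightarrow> 'e signed \<Rightarrow> bool" where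
  "opt_candidate G p E C \<longleftrightarrow> signed_cocycle G C \<and> p \<in> fst C \<and> supp C \<inter> E \<subseteq> fst C"

definition optimal_cocycle :: "('v,'e::linorder) pre_digraph \<Rightarrow> 'e \<Rightarrow> 'e set \<Rightarrow> 'e set \<Rightarrow> 'e signed" where
  "optimal_cocycle G p E F =
     (THE C. opt_candidate G p E C \<and> (\<forall>D. opt_candidate G p E D \<and> D \<noteq> C \<longrightarrow> cocycle_greater F C D))"

subsection \<open>Deletion and contraction\<close>

definition restrict_arcs :: "('v,'e) pre_digraph \<Rightarrow> 'e set \<Rightarrow> ('v,'e) pre_digraph" where
  "restrict_arcs G S = \<lparr>verts = verts G, arcs = arcs G \<inter> S, tail = tail G, head = head G\<rparr>"

text \<open>Contraction of p: the head of p is identified with the tail of p.\<close>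
definition contract_arc :: "('v,'e) pre_digraph \<Rightarrow> 'e \<Rightarrow> ('v,'e) pre_digraph" where
  "contract_arc G p =
     (let m = (\<lambda>v. if v = head G p then tail G p else v)
      in \<lparr>verts = m ` verts G, arcs = arcs G - {p}, tail = m \<circ> tail G, head = m \<circ> head G\<rparr>)"

subsection \<open>The algorithm\<close>

text \<open>State: (current digraph, infinity edge p, ground set E, objective set F).\<close>
type_synonym ('v,'e) alg_state = "('v,'e) pre_digraph \<times> 'e \<times> 'e set \<times> 'e set"

definition alg_step :: "('v,'e::linorder) alg_state \<Rightarrow> ('v,'e) alg_state \<times> 'e" where
  "alg_step s = (case s of (G, p, E, F) \<Rightarrow>
     (let Copt = optimal_cocycle G p E F;
          t = Min (E - supp Copt);
          p' = t;
          E' = E - supp Copt;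
          F' = (if p' \<in> F then F - {p'}
                else F - {Max (F \<inter> supp (fund_cycle G (F \<union> {p}) p'))});
          G' = contract_arc (restrict_arcs G (E' \<union> F' \<union> {p})) p
      in ((G', p', E', F'), t)))"

fun alg_iter :: "nat \<Rightarrow> ('v,'e::linorder) alg_state \<Rightarrow> 'e set" where
  "alg_iter 0 s = {}"
| "alg_iter (Suc k) s = (case alg_step s of (s', t) \<Rightarrow> insert t (alg_iter k s'))"

text \<open>Lexicographically smallest spanning tree (comparing increasingly sorted lists).\<close>
definition lex_min_tree :: "('v,'e::linorder) pre_digraph \<Rightarrow> 'e set" where
  "lex_min_tree G = (THE T. spanning_tree G T \<and>
     (\<forall>T'. spanning_tree G T' \<and> T' \<noteq> T \<longrightarrow>
        (sorted_list_of_set T, sorted_list_of_set T') \<in> lexord {(x, y). x < y}))"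

text \<open>Output {p, t_2, ..., t_r}: r - 1 iterations, r = number of edges of a spanning tree.\<close>
definition alg_output :: "('v,'e::linorder) pre_digraph \<Rightarrow> 'e set" where
  "alg_output G =
     (let p = Min (arcs G); T0 = lex_min_tree G
      in insert p (alg_iter (card T0 - 1) (G, p, arcs G, T0 - {p})))"

end

theory Submission
  imports Defs "HOL-Library.List_Lexorder"
begin

text \<open>Let \<open>T\<close> be fully optimal and let \<open>M t\<close> be the fundamental cocycle of \<open>t \<in> T\<close>. The cycle
conditions say that \<open>M t\<close> is nonnegative on the edges avoiding \<open>M t'\<close> for all \<open>t' < t\<close>, and the
cocycle conditions say that \<open>M t\<close> (\<open>t \<noteq> p\<close>) is negative at its smallest edge, which lies in the
lexicographically smallest tree. A candidate \<open>D\<close> for the optimal cocycle satisfies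
\<open>D - M p = (\<Sum>t\<in>D \<inter> T - {p}. M t)\<close>, which is negative at its first nonzero entry; hence \<open>M p\<close> is the
optimal cocycle. Both sets of conditions pass to \<open>T - {p}\<close> in the next state, the cocycle ones because
a cycle and a cocycle never meet in a single edge. So the algorithm outputs every fully optimal tree,
which proves uniqueness. Existence follows by choosing lexicographically largest cuts greedily.

Cuts are handled as coboundaries of vertex potentials, so that cycle--cocycle orthogonality is a
telescoping sum.\<close>

text \<open>The numbers \<open>M t e\<close> behave like a simplex tableau with tree edges as rows
  and all edges as columns: the cycle conditions are read down columns, the cocycle conditions along
  rows, and a pivot is an exchange of tree edges. Lexicographically negative rows stay so under
  addition, which turns the expansion of a candidate into a comparison. The algorithm never sees
  \<open>T\<close>. It still picks tree edges, because an edge of the ground set outside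
  \<open>T\<close> has, as first nonzero entry of its column, one in the row of a smaller tree edge;
  if the edge avoids the optimal cocycle, that row is not row \<open>p\<close>, so the smaller tree
  edge survives too. The obstacle is that edges get deleted, so the row conditions have to live on
  the objective set alone. Starting from the lexicographically smallest tree guarantees that no
  first nonzero entry is missed initially; discarding the largest objective edge of the fundamental
  cycle guarantees that none is lost later.\<close>

definition dif :: "('v,'e) pre_digraph \<Rightarrow> ('v \<Rightarrow> int) \<Rightarrow> 'e \<Rightarrow> int" where
  "dif G x e = x (tail G e) - x (head G e)"

text \<open>The signed incidence vector of a cocycle as a coboundary. Arbitrary integer potentials
  are allowed in \<open>dif\<close> because differences and combinations of cuts occur
  throughout.\<close>

abbreviation cut :: "('v,'e) pre_digraph \<Rightarrow> 'v set \<Rightarrow> 'e \<Rightarrow> int" where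
  "cut G X \<equiv> dif G (\<lambda>v. of_bool (v \<in> X))"

lemma cut_cases: "cut G X e = -1 \<or> cut G X e = 0 \<or> cut G X e = 1"
  by (auto simp: dif_def)

lemma mem_out_cut_iff: "e \<in> out_cut G X \<longleftrightarrow> e \<in> arcs G \<and> cut G X e = 1"
  by (auto simp: out_cut_def dif_def)

lemma mem_in_cut_iff: "e \<in> in_cut G X \<longleftrightarrow> e \<in> arcs G \<and> cut G X e = -1"
  by (auto simp: in_cut_def dif_def)

lemma mem_cut_supp_iff: "e \<in> out_cut G X \<union> in_cut G X \<longleftrightarrow> e \<in> arcs G \<and> cut G X e \<noteq> 0"
  by (auto simp: in_cut_def out_cut_def dif_def)

lemma dif_diff: "dif G (\<lambda>v. x v - y v) e = dif G x e - dif G y e"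
  by (simp add: dif_def)

lemma dif_scale: "dif G (\<lambda>v. c * x v) e = c * dif G x e"
  by (simp add: dif_def right_diff_distrib)

lemma dif_sum: "dif G (\<lambda>v. \<Sum>i\<in>A. x i v) e = (\<Sum>i\<in>A. dif G (x i) e)"
  by (simp add: dif_def sum_subtractf)

text \<open>Rounds a potential to a genuine cut: a superlevel set of \<open>x\<close> is crossed
  outwards only where \<open>x\<close> drops and inwards only where it rises, and the level of the
  higher end of \<open>t\<close> separates the ends of \<open>t\<close>.\<close>

lemma threshold_cut:
  assumes "dif G x t \<noteq> 0" and wf: "wf_digraph G"
  obtains X where "X \<subseteq> verts G" "t \<in> arcs G \<Longrightarrow> cut G X t = sgn (dif G x t)"
    "\<And>e. e \<in> arcs G \<Longrightarrow> dif G x e \<ge> 0 \<Longrightarrow> cut G X e \<ge> 0"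
    "\<And>e. e \<in> arcs G \<Longrightarrow> dif G x e = 0 \<Longrightarrow> cut G X e = 0"
proof
  interpret wf_digraph G by (rule wf)
  let ?X = "{v \<in> verts G. x v \<ge> max (x (tail G t)) (x (head G t))}"
  show "?X \<subseteq> verts G" by auto
  show "t \<in> arcs G \<Longrightarrow> cut G ?X t = sgn (dif G x t)"
    using assms by (auto simp: dif_def max_def sgn_if)
  show "\<And>e. e \<in> arcs G \<Longrightarrow> dif G x e \<ge> 0 \<Longrightarrow> cut G ?X e \<ge> 0"
    by (auto simp: dif_def)
  show "\<And>e. e \<in> arcs G \<Longrightarrow> dif G x e = 0 \<Longrightarrow> cut G ?X e = 0"
    by (auto simp: dif_def)
qed

subsection \<open>Closed walks\<close>

definition step_src :: "('v,'e) pre_digraph \<Rightarrow> 'e \<times> bool \<Rightarrow> 'v" where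
  "step_src G s = (if snd s then tail G (fst s) else head G (fst s))"

definition step_tgt :: "('v,'e) pre_digraph \<Rightarrow> 'e \<times> bool \<Rightarrow> 'v" where
  "step_tgt G s = (if snd s then head G (fst s) else tail G (fst s))"

text \<open>Replaces lists by functions on indices, so that sums around the cycle can be
  reindexed.\<close>

lemma signed_cycle_iff:
  "signed_cycle G C \<longleftrightarrow>
     (\<exists>n v s. 0 < n \<and> inj_on v {..<n} \<and> inj_on (fst \<circ> s) {..<n} \<and>
        (\<forall>i<n. fst (s i) \<in> arcs G \<and> step_src G (s i) = v i \<and> step_tgt G (s i) = v (Suc i mod n)) \<and>
        fst C = {fst (s i) | i. i < n \<and> snd (s i)} \<and> snd C = {fst (s i) | i. i < n \<and> \<not> snd (s i)})"
    (is "_ \<longleftrightarrow> ?R")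
proof
  assume "signed_cycle G C"
  then obtain vs :: "'a list" and es where 1: "length vs \<ge> 1" "length es = length vs" "distinct vs"
    "distinct (map fst es)" "\<forall>i < length vs. fst (es ! i) \<in> arcs G \<and>
           (if snd (es ! i)
            then tail G (fst (es ! i)) = vs ! i \<and> head G (fst (es ! i)) = vs ! ((i + 1) mod length vs)
            else head G (fst (es ! i)) = vs ! i \<and> tail G (fst (es ! i)) = vs ! ((i + 1) mod length vs))"
    "fst C = {fst (es ! i) | i. i < length vs \<and> snd (es ! i)}"
    "snd C = {fst (es ! i) | i. i < length vs \<and> \<not> snd (es ! i)}"
    unfolding signed_cycle_def by (elim exE conjE) (rule that; assumption)
  have "inj_on (\<lambda>i. vs ! i) {..<length vs}" using 1 by (simp add: inj_on_nth)
  moreover have "inj_on (fst \<circ> (\<lambda>i. es ! i)) {..<length vs}"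
    using inj_on_nth[OF 1(4), of "{..<length vs}"] 1(2) by (auto simp: inj_on_def)
  ultimately show ?R using 1
    by (intro exI[of _ "length vs"] exI[of _ "\<lambda>i. vs ! i"] exI[of _ "\<lambda>i. es ! i"])
       (auto simp: step_src_def step_tgt_def)
next
  assume ?R
  then obtain n and v :: "nat \<Rightarrow> 'a" and s where 1: "0 < n" "inj_on v {..<n}" "inj_on (fst \<circ> s) {..<n}"
     "\<forall>i<n. fst (s i) \<in> arcs G \<and> step_src G (s i) = v i \<and> step_tgt G (s i) = v (Suc i mod n)"
     "fst C = {fst (s i) | i. i < n \<and> snd (s i)}" "snd C = {fst (s i) | i. i < n \<and> \<not> snd (s i)}"
    by (elim exE conjE) (rule that; assumption)
  have eq: "{fst (map s [0..<n] ! i) | i. i < length (map v [0..<n]) \<and> P (map s [0..<n] ! i)} = {fst (s i) | i. i < n \<and> P (s i)}" for P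
  proof (intro Collect_cong ex_cong1)
    fix e i
    show "(e = fst (map s [0..<n] ! i) \<and> i < length (map v [0..<n]) \<and> P (map s [0..<n] ! i)) \<longleftrightarrow> (e = fst (s i) \<and> i < n \<and> P (s i))"
      by (cases "i < n") auto
  qed
  have dist: "distinct (map v [0..<n])" "distinct (map fst (map s [0..<n]))"
    using 1(2,3) by (simp_all add: distinct_map atLeast0LessThan)
  show "signed_cycle G C" unfolding signed_cycle_def
  proof (intro exI[of _ "map v [0..<n]"] exI[of _ "map s [0..<n]"] conjI allI impI)
    fix i assume "i < length (map v [0..<n])"
    then have i: "i < n" "Suc i mod n < n" by auto
    show "fst (map s [0..<n] ! i) \<in> arcs G" using 1(4) i by simp
    show "if snd (map s [0..<n] ! i)
      then tail G (fst (map s [0..<n] ! i)) = map v [0..<n] ! i \<and>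
           head G (fst (map s [0..<n] ! i)) = map v [0..<n] ! ((i + 1) mod length (map v [0..<n]))
      else head G (fst (map s [0..<n] ! i)) = map v [0..<n] ! i \<and>
           tail G (fst (map s [0..<n] ! i)) = map v [0..<n] ! ((i + 1) mod length (map v [0..<n]))"
      using 1(4)[rule_format, OF i(1)] i by (cases "snd (s i)") (simp_all add: step_src_def step_tgt_def)
  qed (use 1 dist eq[of snd] eq[of "\<lambda>s. \<not> snd s"] in simp_all)
qed

text \<open>Potential differences telescope around the closed walk; backward steps enter with the
  opposite sign and are moved to the other side.\<close>

lemma signed_cycle_orthogonal:
  assumes "signed_cycle G C"
  shows "(\<Sum>e\<in>fst C. dif G x e) = (\<Sum>e\<in>snd C. dif G x e)"
proof -
  obtain n v s where 1: "0 < n" "inj_on v {..<n}" "inj_on (fst \<circ> s) {..<n}"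
     "\<forall>i<n. fst (s i) \<in> arcs G \<and> step_src G (s i) = v i \<and> step_tgt G (s i) = v (Suc i mod n)"
     "fst C = {fst (s i) | i. i < n \<and> snd (s i)}" "snd C = {fst (s i) | i. i < n \<and> \<not> snd (s i)}"
    using assms unfolding signed_cycle_iff by (elim exE conjE) (rule that; assumption)
  let ?P = "{i. i < n \<and> snd (s i)}" and ?N = "{i. i < n \<and> \<not> snd (s i)}"
  have F: "fst C = (fst \<circ> s) ` ?P" and N: "snd C = (fst \<circ> s) ` ?N"
    using 1(5,6) by auto
  have "(\<Sum>i<n. x (v i) - x (v (Suc i mod n))) = 0"
  proof -
    \<comment> \<open>The cyclic shift permutes the indices, so the sums over sources and over
      targets of the steps cancel.\<close>
    have "bij_betw (\<lambda>i. Suc i mod n) {..<n} {..<n}"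
    proof (rule bij_betw_imageI)
      show "inj_on (\<lambda>i. Suc i mod n) {..<n}"
        by (rule inj_onI) (auto simp: mod_Suc split: if_splits)
      then show "(\<lambda>i. Suc i mod n) ` {..<n} = {..<n}"
        using 1(1) by (intro endo_inj_surj) auto
    qed
    then have "(\<Sum>i<n. x (v (Suc i mod n))) = (\<Sum>i<n. x (v i))"
      by (rule sum.reindex_bij_betw)
    then show ?thesis by (simp add: sum_subtractf)
  qed
  moreover have "{..<n} = ?P \<union> ?N" "?P \<inter> ?N = {}" by auto
  ultimately have 2: "(\<Sum>i\<in>?P. x (v i) - x (v (Suc i mod n))) + (\<Sum>i\<in>?N. x (v i) - x (v (Suc i mod n))) = 0"
    by (metis (no_types, lifting) finite_lessThan finite_Un sum.union_disjoint)
  have "(\<Sum>i\<in>?P. x (v i) - x (v (Suc i mod n))) = (\<Sum>i\<in>?P. dif G x (fst (s i)))"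
    using 1(4) by (intro sum.cong) (auto simp: dif_def step_src_def step_tgt_def)
  also have "\<dots> = (\<Sum>e\<in>fst C. dif G x e)" unfolding F
    by (subst sum.reindex) (auto intro: inj_on_subset[OF 1(3)])
  finally have 3: "(\<Sum>i\<in>?P. x (v i) - x (v (Suc i mod n))) = (\<Sum>e\<in>fst C. dif G x e)" .
  have "(\<Sum>i\<in>?N. x (v i) - x (v (Suc i mod n))) = (\<Sum>i\<in>?N. - dif G x (fst (s i)))"
    using 1(4) by (intro sum.cong) (auto simp: dif_def step_src_def step_tgt_def)
  also have "\<dots> = (\<Sum>e\<in>snd C. - dif G x e)" unfolding N
    by (subst sum.reindex) (auto intro: inj_on_subset[OF 1(3)])
  finally have "(\<Sum>i\<in>?N. x (v i) - x (v (Suc i mod n))) = - (\<Sum>e\<in>snd C. dif G x e)"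
    by (simp add: sum_negf)
  with 2 3 show ?thesis by linarith
qed

lemma signed_cycle_basic:
  assumes "signed_cycle G C"
  shows "supp C \<subseteq> arcs G" "supp C \<noteq> {}" "finite (supp C)" "fst C \<inter> snd C = {}"
proof -
  obtain n v s where 1: "0 < n" "inj_on v {..<n}" "inj_on (fst \<circ> s) {..<n}"
     "\<forall>i<n. fst (s i) \<in> arcs G \<and> step_src G (s i) = v i \<and> step_tgt G (s i) = v (Suc i mod n)"
     "fst C = {fst (s i) | i. i < n \<and> snd (s i)}" "snd C = {fst (s i) | i. i < n \<and> \<not> snd (s i)}"
    using assms unfolding signed_cycle_iff by (elim exE conjE) (rule that; assumption)
  have S: "supp C = (fst \<circ> s) ` {..<n}" unfolding supp_def 1(5,6) by auto
  show "supp C \<subseteq> arcs G" "supp C \<noteq> {}" "finite (supp C)" unfolding S using 1 by auto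
  show "fst C \<inter> snd C = {}" unfolding 1(5,6) using 1(3) by (auto simp: inj_on_def)
qed

text \<open>The form in which orthogonality is used: a cycle cannot meet the support of a coboundary
  in exactly one edge. Tree acyclicity, lexicographic minimality and the update of the objective set
  all rest on it.\<close>

lemma signed_cycle_not_single:
  assumes C: "signed_cycle G C" and e: "e \<in> supp C"
    and z: "\<And>a. a \<in> supp C \<Longrightarrow> a \<noteq> e \<Longrightarrow> dif G x a = 0"
  shows "dif G x e = 0"
proof -
  have fin: "finite (fst C)" "finite (snd C)" using signed_cycle_basic(3)[OF C] by (auto simp: supp_def)
  have "(\<Sum>a\<in>A. dif G x a) = (if e \<in> A then dif G x e else 0)" if "A \<subseteq> supp C" "finite A" for A
  proof -
    have "(\<Sum>a\<in>A. dif G x a) = (\<Sum>a\<in>A. if a = e then dif G x e else 0)"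
      using z that(1) by (intro sum.cong) auto
    then show ?thesis using that(2) by simp
  qed
  from this[of "fst C"] this[of "snd C"] fin
  have "(if e \<in> fst C then dif G x e else 0) = (if e \<in> snd C then dif G x e else 0)"
    using signed_cycle_orthogonal[OF C, of x] by (simp add: supp_def)
  then show ?thesis using signed_cycle_basic(4)[OF C] e by (auto simp: supp_def split: if_splits)
qed

text \<open>The condition on the reverse of the closing arc excludes going back and forth along it.\<close>
lemma closing_cycle:
  assumes W: "(u, v) \<in> {(step_src G s, step_tgt G s) | s. s \<in> W}\<^sup>*"
    and "fst ` W \<subseteq> arcs G" "e \<in> arcs G" "tail G e = v" "head G e = u" "(e, False) \<notin> W"
  obtains C where "signed_cycle G C" "e \<in> fst C"
    "fst C \<subseteq> insert e {a. (a, True) \<in> W}" "snd C \<subseteq> {a. (a, False) \<in> W}"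
proof -
  let ?R = "{(step_src G s, step_tgt G s) | s. s \<in> W}"
  \<comment> \<open>A shortest walk repeats no vertex, since the part between two visits could be
    cut out.\<close>
  define n where "n = (LEAST n. (u, v) \<in> ?R ^^ n)"
  have ex: "\<exists>n. (u, v) \<in> ?R ^^ n" using W rtrancl_imp_relpow by blast
  have n: "(u, v) \<in> ?R ^^ n" unfolding n_def using ex by (rule LeastI_ex)
  have least: "n \<le> m" if "(u, v) \<in> ?R ^^ m" for m unfolding n_def using that by (rule Least_le)
  obtain f where f: "f 0 = u" "f n = v" "\<forall>i<n. (f i, f (Suc i)) \<in> ?R"
    using n unfolding relpow_fun_conv by blast
  have seg: "(f i, f j) \<in> ?R ^^ (j - i)" if "i \<le> j" "j \<le> n" for i j
    unfolding relpow_fun_conv using that f(3) by (intro exI[of _ "\<lambda>k. f (i + k)"]) auto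
  have inj: "f i \<noteq> f j" if "i < j" "j \<le> n" for i j
  proof
    assume "f i = f j"
    then have "(u, f i) \<in> ?R ^^ i" "(f i, v) \<in> ?R ^^ (n - j)"
      using seg[of 0 i] seg[of j n] f(1,2) that by simp_all
    then have "(u, v) \<in> ?R ^^ (i + (n - j))" unfolding relpow_add by blast
    then show False using least that by fastforce
  qed
  have "\<exists>s. s \<in> W \<and> step_src G s = f i \<and> step_tgt G s = f (Suc i)" if "i < n" for i
    using f(3)[rule_format, OF that] unfolding mem_Collect_eq prod.inject by metis
  then obtain g where g: "\<And>i. i < n \<Longrightarrow> g i \<in> W \<and> step_src G (g i) = f i \<and> step_tgt G (g i) = f (Suc i)"
    by metis
  define s where "s i = (if i < n then g i else (e, True))" for i
  have src: "step_src G (s i) = f i" if "i \<le> n" for i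
  proof (cases "i < n")
    case True
    then show ?thesis using g by (simp add: s_def)
  next
    case False
    then show ?thesis using that f(2) assms(4) by (simp add: s_def step_src_def)
  qed
  have tgt: "step_tgt G (s i) = f (Suc i mod Suc n)" if "i \<le> n" for i
  proof (cases "i < n")
    case True
    then show ?thesis using g by (simp add: s_def)
  next
    case False
    then show ?thesis using that f(1) assms(5) by (simp add: s_def step_tgt_def)
  qed
  have injf: "f i = f j \<longleftrightarrow> i = j" if "i \<le> n" "j \<le> n" for i j
    using inj[of i j] inj[of j i] that by (metis nat_neq_iff)
  have injs: "i = j" if "i \<le> n" "j \<le> n" "fst (s i) = fst (s j)" for i j
  proof (rule ccontr)
    assume ne: "i \<noteq> j"
    have ns: "snd (s i) \<noteq> snd (s j)"
    proof
      assume "snd (s i) = snd (s j)"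
      then have "s i = s j" using that by (simp add: prod_eq_iff)
      then show False using src[of i] src[of j] that injf ne by metis
    qed
    \<comment> \<open>Two opposite traversals of one edge are cyclic successors of each other. One
      of them must then be the closing step, and the other would be \<open>(e, False)\<close>, which
      is not in \<open>W\<close>.\<close>
    then have "step_src G (s i) = step_tgt G (s j)" "step_src G (s j) = step_tgt G (s i)"
      using that by (auto simp: step_src_def step_tgt_def)
    then have "f i = f (Suc j mod Suc n)" "f j = f (Suc i mod Suc n)"
      using src[OF that(1)] src[OF that(2)] tgt[OF that(1)] tgt[OF that(2)] by simp_all
    moreover have "Suc k mod Suc n \<le> n" for k using mod_less_divisor[of "Suc n" "Suc k"] by linarith
    ultimately have *: "i = Suc j mod Suc n" "j = Suc i mod Suc n"
      using injf that by blast+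
    have "i = n \<or> j = n"
    proof (rule ccontr)
      assume "\<not> ?thesis"
      then have "Suc j mod Suc n = Suc j" "Suc i mod Suc n = Suc i" using that by simp_all
      with * have "i = Suc j" "j = Suc i" by (metis, metis)
      then show False by linarith
    qed
    then have "(s i = (e, True) \<and> s j \<in> W) \<or> (s j = (e, True) \<and> s i \<in> W)"
      using ne that g by (auto simp: s_def)
    then show False using ns that(3) assms(6) by (cases "s i"; cases "s j") auto
  qed
  let ?C = "({fst (s i) | i. i < Suc n \<and> snd (s i)}, {fst (s i) | i. i < Suc n \<and> \<not> snd (s i)})"
  have sW: "s i \<in> insert (e, True) W" for i using g by (auto simp: s_def)
  have sarcs: "fst (s i) \<in> arcs G" for i using sW[of i] assms(2,3) by auto
  have "signed_cycle G ?C" unfolding signed_cycle_iff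
  proof (intro exI[of _ "Suc n"] exI[of _ f] exI[of _ s] conjI allI impI)
    show "inj_on f {..<Suc n}" "inj_on (fst \<circ> s) {..<Suc n}"
      using injf injs by (auto simp: inj_on_def less_Suc_eq_le)
  qed (use src tgt sarcs in \<open>simp_all add: less_Suc_eq_le\<close>)
  moreover have "e \<in> fst ?C" by (auto simp: s_def intro!: exI[of _ n])
  moreover have "fst ?C \<subseteq> insert e {a. (a, True) \<in> W}" "snd ?C \<subseteq> {a. (a, False) \<in> W}"
  proof -
    show "fst ?C \<subseteq> insert e {a. (a, True) \<in> W}"
    proof
      fix a assume "a \<in> fst ?C"
      then obtain i where "a = fst (s i)" "snd (s i)" by auto
      then show "a \<in> insert e {a. (a, True) \<in> W}" using sW[of i] by (cases "s i") auto
    qed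
    show "snd ?C \<subseteq> {a. (a, False) \<in> W}"
    proof
      fix a assume "a \<in> snd ?C"
      then obtain i where "a = fst (s i)" "\<not> snd (s i)" by auto
      then show "a \<in> {a. (a, False) \<in> W}" using sW[of i] by (cases "s i") auto
    qed
  qed
  ultimately show ?thesis using that by blast
qed

lemma ulink_sym: "(u, v) \<in> (ulink G S)\<^sup>* \<Longrightarrow> (v, u) \<in> (ulink G S)\<^sup>*"
proof -
  have "sym (ulink G S)" by (auto simp: ulink_def sym_def)
  then show "(u, v) \<in> (ulink G S)\<^sup>* \<Longrightarrow> (v, u) \<in> (ulink G S)\<^sup>*"
    using sym_rtrancl symD by metis
qed

lemma undirected_closing_cycle:
  assumes "(head G e, tail G e) \<in> (ulink G S)\<^sup>*" "e \<in> arcs G" "e \<notin> S"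
  obtains C where "signed_cycle G C" "e \<in> fst C" "supp C \<subseteq> insert e S"
proof -
  let ?W = "(S \<inter> arcs G) \<times> UNIV"
  have "ulink G S \<subseteq> {(step_src G s, step_tgt G s) | s. s \<in> ?W}"
  proof -
    have "a \<in> S \<inter> arcs G \<Longrightarrow> (tail G a, head G a) = (step_src G (a, True), step_tgt G (a, True))"
      "a \<in> S \<inter> arcs G \<Longrightarrow> (head G a, tail G a) = (step_src G (a, False), step_tgt G (a, False))" for a
      by (auto simp: step_src_def step_tgt_def)
    then show ?thesis unfolding ulink_def by blast
  qed
  then have "(head G e, tail G e) \<in> {(step_src G s, step_tgt G s) | s. s \<in> ?W}\<^sup>*"
    using assms(1) rtrancl_mono by blast
  then obtain C where "signed_cycle G C" "e \<in> fst C"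
    "fst C \<subseteq> insert e {a. (a, True) \<in> ?W}" "snd C \<subseteq> {a. (a, False) \<in> ?W}"
    by (rule closing_cycle) (use assms in auto)
  then show ?thesis by (intro that) (auto simp: supp_def)
qed

lemma directed_closing_cycle:
  assumes "(head G e, tail G e) \<in> {(tail G a, head G a) | a. a \<in> arcs G}\<^sup>*" "e \<in> arcs G"
  shows "\<not> acyclic_digraph G"
proof -
  let ?W = "arcs G \<times> {True}"
  have "{(tail G a, head G a) | a. a \<in> arcs G} \<subseteq> {(step_src G s, step_tgt G s) | s. s \<in> ?W}"
    by (force simp: step_src_def step_tgt_def)
  then have "(head G e, tail G e) \<in> {(step_src G s, step_tgt G s) | s. s \<in> ?W}\<^sup>*"
    using assms(1) rtrancl_mono by blast
  then obtain C where "signed_cycle G C" "snd C \<subseteq> {a. (a, False) \<in> ?W}"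
    by (rule closing_cycle) (use assms in auto)
  moreover from this have "snd C = {}" by auto
  ultimately show ?thesis unfolding acyclic_digraph_def by blast
qed

text \<open>Count the vertices reachable from \<open>v\<close>: the tail of an edge reaches all that
  the head reaches, and also itself, which the head does not reach without a directed cycle.\<close>

lemma acyclic_potential:
  assumes "fin_digraph G" "acyclic_digraph G"
  obtains y where "\<And>e. e \<in> arcs G \<Longrightarrow> dif G y e \<ge> 1"
proof
  interpret fin_digraph G by fact
  let ?R = "{(tail G a, head G a) | a. a \<in> arcs G}"
  let ?y = "\<lambda>v. int (card {w \<in> verts G. (v, w) \<in> ?R\<^sup>*})"
  fix e assume e: "e \<in> arcs G"
  have "(head G e, tail G e) \<notin> ?R\<^sup>*" 
    by (rule notI) (rule notE[OF directed_closing_cycle[OF _ e] assms(2)])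
  moreover have "(tail G e, head G e) \<in> ?R" using e by blast
  then have step: "(tail G e, w) \<in> ?R\<^sup>*" if "(head G e, w) \<in> ?R\<^sup>*" for w
    using that by (rule converse_rtrancl_into_rtrancl)
  have "{w \<in> verts G. (head G e, w) \<in> ?R\<^sup>*} \<subseteq> {w \<in> verts G. (tail G e, w) \<in> ?R\<^sup>*}"
    by (intro Collect_mono conj_mono impI step)
  moreover have "tail G e \<in> verts G" using e by (rule tail_in_verts)
  ultimately have "card {w \<in> verts G. (head G e, w) \<in> ?R\<^sup>*} < card {w \<in> verts G. (tail G e, w) \<in> ?R\<^sup>*}"
    by (intro psubset_card_mono psubsetI) (simp, assumption, metis (mono_tags, lifting) mem_Collect_eq rtrancl.rtrancl_refl)
  then show "dif G ?y e \<ge> 1" unfolding dif_def by linarith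
qed

subsection \<open>Spanning trees and their dual cuts\<close>

text \<open>For a spanning tree, \<open>X t\<close> is the side of the fundamental cocycle of
  \<open>t\<close> that contains the tail of \<open>t\<close>; the cuts form the basis of the cut
  space dual to \<open>T\<close>.\<close>

definition dual_cuts :: "('v,'e) pre_digraph \<Rightarrow> 'e set \<Rightarrow> ('e \<Rightarrow> 'v set) \<Rightarrow> bool" where
  "dual_cuts G T X \<longleftrightarrow>
     (\<forall>t\<in>T. X t \<subseteq> verts G \<and> (\<forall>t'\<in>T. cut G (X t) t' = of_bool (t = t')))"

lemma connected_by_const:
  assumes "connected_by G S" "\<And>e. e \<in> S \<inter> arcs G \<Longrightarrow> dif G x e = 0" "u \<in> verts G" "v \<in> verts G"
  shows "x u = x v"
proof -
  have "(u, v) \<in> (ulink G S)\<^sup>*" using assms unfolding connected_by_def by auto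
  then show ?thesis
  proof induction
    case (step a b)
    then show ?case using assms(2) by (auto simp: ulink_def dif_def)
  qed simp
qed

text \<open>Tests connectivity by potentials, via the indicator of the set reachable from
  \<open>u\<close>. Exchange and contraction then need no path arguments.\<close>

lemma connected_byI:
  assumes "wf_digraph G"
    and "\<And>x u v. (\<And>e. e \<in> S \<inter> arcs G \<Longrightarrow> dif G x e = 0) \<Longrightarrow> u \<in> verts G \<Longrightarrow> v \<in> verts G \<Longrightarrow> x u = x v"
  shows "connected_by G S"
  unfolding connected_by_def
proof (intro ballI)
  fix u v assume uv: "u \<in> verts G" "v \<in> verts G"
  let ?x = "\<lambda>w. of_bool ((u, w) \<in> (ulink G S)\<^sup>*) :: int"
  have "?x u = ?x v"
  proof (rule assms(2))
    fix e assume "e \<in> S \<inter> arcs G"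
    then have "(tail G e, head G e) \<in> ulink G S" "(head G e, tail G e) \<in> ulink G S"
      by (auto simp: ulink_def)
    then show "dif G ?x e = 0" by (auto simp: dif_def intro: rtrancl_into_rtrancl)
  qed (use uv in auto)
  then show "(u, v) \<in> (ulink G S)\<^sup>*" by (simp split: if_splits)
qed

lemma connected_by_dif_eq_0:
  assumes "wf_digraph G" "connected_by G S" "\<And>e. e \<in> S \<inter> arcs G \<Longrightarrow> dif G x e = 0" "e \<in> arcs G"
  shows "dif G x e = 0"
  using connected_by_const[of G S x "tail G e" "head G e"] assms
  by (simp add: dif_def wf_digraph_def)

text \<open>Acyclicity is certified edge by edge: a cycle inside \<open>T\<close> through
  \<open>t\<close> would meet the given coboundary in \<open>t\<close> alone.\<close>

lemma spanning_treeI: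
  assumes "T \<subseteq> arcs G" "connected_by G T"
    and "\<And>t. t \<in> T \<Longrightarrow> \<exists>x. dif G x t \<noteq> 0 \<and> (\<forall>t'\<in>T - {t}. dif G x t' = 0)"
  shows "spanning_tree G T"
  unfolding spanning_tree_def
proof (intro conjI notI)
  assume "\<exists>D. is_cycle G D \<and> D \<subseteq> T"
  then obtain C where C: "signed_cycle G C" "supp C \<subseteq> T" unfolding is_cycle_def by blast
  then obtain t where t: "t \<in> supp C" using signed_cycle_basic(2) by blast
  then obtain x where "dif G x t \<noteq> 0" "\<forall>t'\<in>T - {t}. dif G x t' = 0" using assms(3) C(2) by blast
  then show False using signed_cycle_not_single[OF C(1) t, of x] C(2) by blast
qed (use assms in auto)

text \<open>Take the component of the tail of \<open>t\<close> in \<open>T - {t}\<close>; it misses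
  the head of \<open>t\<close>, for a path between them would close a cycle in
  \<open>T\<close>.\<close>

lemma spanning_tree_dual_cuts:
  assumes "wf_digraph G" "spanning_tree G T"
  obtains X where "dual_cuts G T X"
proof
  interpret wf_digraph G by fact
  have TA: "T \<subseteq> arcs G" using assms(2) by (simp add: spanning_tree_def)
  let ?X = "\<lambda>t. {v \<in> verts G. (tail G t, v) \<in> (ulink G (T - {t}))\<^sup>*}"
  have "cut G (?X t) t' = of_bool (t = t')" if t: "t \<in> T" "t' \<in> T" for t t'
  proof (cases "t' = t")
    case True
    have "(tail G t, head G t) \<notin> (ulink G (T - {t}))\<^sup>*"
    proof
      assume "(tail G t, head G t) \<in> (ulink G (T - {t}))\<^sup>*"
      then obtain C where "signed_cycle G C" "t \<in> fst C" "supp C \<subseteq> insert t (T - {t})"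
        by (rule undirected_closing_cycle[OF ulink_sym]) (use TA t in auto)
      then have "is_cycle G (supp C)" "supp C \<subseteq> T" using t unfolding is_cycle_def by blast+
      then show False using assms(2) unfolding spanning_tree_def by blast
    qed
    then show ?thesis using True t TA by (auto simp: dif_def)
  next
    case False
    then have "(tail G t', head G t') \<in> ulink G (T - {t})" "(head G t', tail G t') \<in> ulink G (T - {t})"
      using t TA by (auto simp: ulink_def)
    then show ?thesis using False t TA by (auto simp: dif_def intro: rtrancl_into_rtrancl)
  qed
  then show "dual_cuts G T ?X" unfolding dual_cuts_def by auto
qed

text \<open>Both sides agree on \<open>T\<close>, and a coboundary that vanishes on a connecting set
  vanishes everywhere. So the values on \<open>T\<close> are the coordinates of a coboundary in the
  dual basis.\<close>

lemma tree_expansion: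
  assumes "wf_digraph G" "connected_by G T" "finite T" "dual_cuts G T X" "e \<in> arcs G"
  shows "dif G x e = (\<Sum>t\<in>T. dif G x t * cut G (X t) e)"
proof -
  let ?y = "\<lambda>v. x v - (\<Sum>t\<in>T. dif G x t * of_bool (v \<in> X t))"
  have y: "dif G ?y a = dif G x a - (\<Sum>t\<in>T. dif G x t * cut G (X t) a)" for a
    unfolding dif_diff dif_sum dif_scale ..
  have "dif G ?y e = 0"
  proof (rule connected_by_dif_eq_0[OF assms(1,2) _ assms(5)])
    fix a assume "a \<in> T \<inter> arcs G"
    then have "(\<Sum>t\<in>T. dif G x t * cut G (X t) a) = (\<Sum>t\<in>T. if t = a then dif G x t else 0)"
      using assms(4) by (intro sum.cong) (auto simp: dual_cuts_def)
    with \<open>a \<in> T \<inter> arcs G\<close> show "dif G ?y a = 0" unfolding y using assms(3) by simp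
  qed
  then show ?thesis unfolding y by simp
qed

lemma tree_dif_cong:
  assumes "wf_digraph G" "connected_by G T" "\<And>t. t \<in> T \<Longrightarrow> dif G x t = dif G y t" "e \<in> arcs G"
  shows "dif G x e = dif G y e"
  using connected_by_dif_eq_0[of G T "\<lambda>v. x v - y v"] assms by (simp add: dif_diff)

text \<open>Minimality: a nonempty cut inside that of \<open>Y\<close> must contain
  \<open>t\<close>, otherwise it vanishes on \<open>T\<close> and hence everywhere; then it agrees
  on \<open>T\<close> with plus or minus the cut of \<open>Y\<close>, so it has the same
  support.\<close>

lemma signed_cocycle_cut:
  assumes G: "wf_digraph G" "connected_by G T" and Y: "Y \<subseteq> verts G"
    and t: "t \<in> T" "t \<in> arcs G" "cut G Y t \<noteq> 0" "\<And>t'. t' \<in> T \<Longrightarrow> t' \<noteq> t \<Longrightarrow> cut G Y t' = 0"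
  shows "signed_cocycle G (out_cut G Y, in_cut G Y)"
proof -
  have *: "out_cut G Z \<union> in_cut G Z = out_cut G Y \<union> in_cut G Y"
    if Z: "Z \<subseteq> verts G" "out_cut G Z \<union> in_cut G Z \<noteq> {}"
      "out_cut G Z \<union> in_cut G Z \<subseteq> out_cut G Y \<union> in_cut G Y" for Z
  proof -
    have sub: "cut G Z e = 0" if "e \<in> arcs G" "cut G Y e = 0" for e
      using Z(3) that mem_cut_supp_iff[of e G Z] mem_cut_supp_iff[of e G Y] by blast
    have nz: "cut G Z t \<noteq> 0"
    proof
      assume "cut G Z t = 0"
      then have "cut G Z e = 0" if "e \<in> T \<inter> arcs G" for e using that sub t(4) by (cases "e = t") auto
      then have "cut G Z e = 0" if "e \<in> arcs G" for e using connected_by_dif_eq_0[OF G] that by blast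
      then show False using Z(2) mem_cut_supp_iff[of _ G Z] by blast
    qed
    \<comment> \<open>Both entries at \<open>t\<close> are 1 or -1, so their product is the sign
      that makes the two cuts agree at \<open>t\<close>.\<close>
    let ?c = "cut G Z t * cut G Y t"
    have c: "?c \<noteq> 0" using nz t(3) by simp
    have "dif G (\<lambda>v. of_bool (v \<in> Z) - ?c * of_bool (v \<in> Y)) e = 0" if "e \<in> arcs G" for e
    proof (rule connected_by_dif_eq_0[OF G _ that])
      fix a assume a: "a \<in> T \<inter> arcs G"
      show "dif G (\<lambda>v. of_bool (v \<in> Z) - ?c * of_bool (v \<in> Y)) a = 0"
        unfolding dif_diff dif_scale
        using a sub[of a] t(4)[of a] cut_cases[of G Y t] t(3) by (cases "a = t") auto
    qed
    then have "cut G Z e = ?c * cut G Y e" if "e \<in> arcs G" for e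
      using that unfolding dif_diff dif_scale by fastforce
    then have "cut G Z e \<noteq> 0 \<longleftrightarrow> cut G Y e \<noteq> 0" if "e \<in> arcs G" for e using that c by fastforce
    then show ?thesis by (auto simp only: set_eq_iff mem_cut_supp_iff)
  qed
  have "out_cut G Y \<union> in_cut G Y \<noteq> {}" using t(2,3) mem_cut_supp_iff[of t G Y] by blast
  then have "is_cocycle G (supp (out_cut G Y, in_cut G Y))"
    unfolding is_cocycle_def is_cut_def supp_def fst_conv snd_conv using * Y by blast
  then show ?thesis unfolding signed_cocycle_def using Y by auto
qed

lemma cut_eq_imp_eq:
  assumes "\<And>e. e \<in> arcs G \<Longrightarrow> cut G Y e = cut G Z e"
  shows "out_cut G Y = out_cut G Z" "in_cut G Y = in_cut G Z"
  using assms by (auto simp only: set_eq_iff mem_out_cut_iff mem_in_cut_iff)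

lemma fund_cocycle_eq:
  assumes G: "wf_digraph G" "spanning_tree G T" "dual_cuts G T X" "t \<in> T"
  shows "fund_cocycle G T t = (out_cut G (X t), in_cut G (X t))"
  unfolding fund_cocycle_def
proof (rule the_equality)
  have T: "connected_by G T" "T \<subseteq> arcs G" using G(2) by (auto simp: spanning_tree_def)
  have X: "X t \<subseteq> verts G" "cut G (X t) t' = of_bool (t = t')" if "t' \<in> T" for t'
    using G(3,4) that by (auto simp: dual_cuts_def)
  have "signed_cocycle G (out_cut G (X t), in_cut G (X t))"
    by (rule signed_cocycle_cut[OF G(1) T(1)]) (use X T G(4) in auto)
  moreover have "out_cut G (X t) \<union> in_cut G (X t) \<subseteq> (arcs G - T) \<union> {t}"
  proof
    fix e assume "e \<in> out_cut G (X t) \<union> in_cut G (X t)"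
    then have "e \<in> arcs G" "cut G (X t) e \<noteq> 0" unfolding mem_cut_supp_iff by auto
    then show "e \<in> (arcs G - T) \<union> {t}" using X(2)[of e] by (auto split: if_splits)
  qed
  moreover have "t \<in> out_cut G (X t)" unfolding mem_out_cut_iff using X G(4) T by auto
  ultimately show "signed_cocycle G (out_cut G (X t), in_cut G (X t)) \<and>
     supp (out_cut G (X t), in_cut G (X t)) \<subseteq> arcs G - T \<union> {t} \<and> t \<in> fst (out_cut G (X t), in_cut G (X t))"
    by (simp add: supp_def)
next
  fix C assume C: "signed_cocycle G C \<and> supp C \<subseteq> arcs G - T \<union> {t} \<and> t \<in> fst C"
  have T: "connected_by G T" "T \<subseteq> arcs G" using G(2) by (auto simp: spanning_tree_def)
  obtain Y where Y: "Y \<subseteq> verts G" "C = (out_cut G Y, in_cut G Y)"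
    using C unfolding signed_cocycle_def by (metis prod.collapse)
  have "cut G Y a = cut G (X t) a" if "a \<in> T" for a
  proof -
    have "cut G Y a = of_bool (t = a)"
    proof (cases "a = t")
      case True
      have "t \<in> out_cut G Y" using C Y(2) by simp
      with True show ?thesis unfolding mem_out_cut_iff by simp
    next
      case False
      with C Y that have "a \<notin> out_cut G Y \<union> in_cut G Y" by (auto simp: supp_def)
      then show ?thesis using False that T(2) unfolding mem_cut_supp_iff by auto
    qed
    then show ?thesis using G(3,4) that by (simp add: dual_cuts_def)
  qed
  then have "cut G Y e = cut G (X t) e" if "e \<in> arcs G" for e
    using tree_dif_cong[OF G(1) T(1)] that by blast
  then show "C = (out_cut G (X t), in_cut G (X t))" using cut_eq_imp_eq Y(2) by metis
qed

text \<open>Fundamental cycles and cocycles are dual: the cycle meets the cut of \<open>X t\<close>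
  at most in \<open>t\<close> and \<open>e\<close>, so orthogonality ties the sign of
  \<open>t\<close> in the cycle to the entry at \<open>e\<close>, with reversed sign.\<close>

lemma cycle_signs:
  assumes Z: "signed_cycle G Z" "supp Z \<subseteq> insert e T" "e \<in> fst Z"
    and X: "dual_cuts G T X" "t \<in> T" "e \<notin> T"
  shows "t \<in> fst Z \<longleftrightarrow> cut G (X t) e = -1" "t \<in> snd Z \<longleftrightarrow> cut G (X t) e = 1"
proof -
  let ?x = "\<lambda>v. of_bool (v \<in> X t) :: int"
  have fin: "finite (fst Z)" "finite (snd Z)" using signed_cycle_basic(3)[OF Z(1)] by (auto simp: supp_def)
  have disj: "fst Z \<inter> snd Z = {}" using signed_cycle_basic(4)[OF Z(1)] .
  have "(\<Sum>a\<in>A. cut G (X t) a) = of_bool (t \<in> A) + (if e \<in> A then cut G (X t) e else 0)"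
    if "A \<subseteq> supp Z" "finite A" for A
  proof -
    have "(\<Sum>a\<in>A. cut G (X t) a) = (\<Sum>a\<in>A. (if a = t then 1 else 0) + (if a = e then cut G (X t) e else 0))"
      using that(1) Z(2) X by (intro sum.cong) (auto simp: dual_cuts_def)
    then show ?thesis using that(2) by (simp add: sum.distrib)
  qed
  from this[of "fst Z"] this[of "snd Z"] fin
  have "of_bool (t \<in> fst Z) + (if e \<in> fst Z then cut G (X t) e else 0) =
    of_bool (t \<in> snd Z) + (if e \<in> snd Z then cut G (X t) e else 0)"
    using signed_cycle_orthogonal[OF Z(1), of ?x] by (simp add: supp_def)
  moreover have "e \<notin> snd Z" using disj Z(3) by blast
  ultimately have "of_bool (t \<in> fst Z) + cut G (X t) e = (of_bool (t \<in> snd Z) :: int)"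
    using Z(3) by simp
  then show "t \<in> fst Z \<longleftrightarrow> cut G (X t) e = -1" "t \<in> snd Z \<longleftrightarrow> cut G (X t) e = 1"
    using disj by (cases "t \<in> fst Z"; cases "t \<in> snd Z"; auto)+
qed

lemma fund_cycle_props:
  assumes G: "spanning_tree G T" "dual_cuts G T X" "wf_digraph G" "e \<in> arcs G" "e \<notin> T"
  shows "signed_cycle G (fund_cycle G T e)" "supp (fund_cycle G T e) \<subseteq> insert e T"
    "e \<in> fst (fund_cycle G T e)"
    "\<And>t. t \<in> T \<Longrightarrow> t \<in> fst (fund_cycle G T e) \<longleftrightarrow> cut G (X t) e = -1"
    "\<And>t. t \<in> T \<Longrightarrow> t \<in> snd (fund_cycle G T e) \<longleftrightarrow> cut G (X t) e = 1"
proof -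
  interpret wf_digraph G by fact
  let ?P = "\<lambda>C. signed_cycle G C \<and> supp C \<subseteq> T \<union> {e} \<and> e \<in> fst C"
  have "(head G e, tail G e) \<in> (ulink G T)\<^sup>*"
    using G unfolding spanning_tree_def connected_by_def by auto
  then obtain C where "signed_cycle G C" "e \<in> fst C" "supp C \<subseteq> insert e T"
    by (rule undirected_closing_cycle) (use G in auto)
  then have C: "?P C" by simp
  have "\<exists>!C. ?P C"
  proof (rule ex1I[of _ C], rule C)
    fix D assume D: "?P D"
    have e: "e \<notin> snd C" "e \<notin> snd D" using C D signed_cycle_basic(4) by blast+
    have "t \<in> fst D \<longleftrightarrow> t \<in> fst C" "t \<in> snd D \<longleftrightarrow> t \<in> snd C" if "t \<in> T" for t
      using that cycle_signs[of G C e T X t] cycle_signs[of G D e T X t] C D G by auto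
    then show "D = C" using C D e by (auto simp: prod_eq_iff supp_def set_eq_iff)
  qed
  then have P: "?P (fund_cycle G T e)" unfolding fund_cycle_def by (rule theI')
  then show "signed_cycle G (fund_cycle G T e)" "supp (fund_cycle G T e) \<subseteq> insert e T"
    "e \<in> fst (fund_cycle G T e)" by auto
  then show "\<And>t. t \<in> T \<Longrightarrow> t \<in> fst (fund_cycle G T e) \<longleftrightarrow> cut G (X t) e = -1"
    "\<And>t. t \<in> T \<Longrightarrow> t \<in> snd (fund_cycle G T e) \<longleftrightarrow> cut G (X t) e = 1"
    using cycle_signs[of G "fund_cycle G T e" e T X] G by auto
qed

lemma mem_supp_fund_cycle_iff:
  assumes "spanning_tree G T" "dual_cuts G T X" "wf_digraph G" "e \<in> arcs G" "e \<notin> T" "t \<in> T"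
  shows "t \<in> supp (fund_cycle G T e) \<longleftrightarrow> cut G (X t) e \<noteq> 0"
  using fund_cycle_props(4,5)[OF assms(1-5) assms(6)] cut_cases[of G "X t" e]
  by (auto simp: supp_def)

lemma spanning_tree_exchange:
  assumes "fin_digraph G" "spanning_tree G T" "e \<in> arcs G" "e \<notin> T" "z \<in> T" "z \<in> supp (fund_cycle G T e)"
  shows "spanning_tree G (insert e (T - {z}))"
proof -
  interpret fin_digraph G by fact
  have T: "connected_by G T" "T \<subseteq> arcs G" using assms(2) by (auto simp: spanning_tree_def)
  obtain X where X: "dual_cuts G T X" using spanning_tree_dual_cuts[OF wf_digraph assms(2)] .
  then have d: "cut G (X t) t' = of_bool (t = t')" if "t \<in> T" "t' \<in> T" for t t'
    using that unfolding dual_cuts_def by blast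
  have finT: "finite T" using T finite_subset by fastforce
  have z: "cut G (X z) e \<noteq> 0"
    using mem_supp_fund_cycle_iff[OF assms(2) X wf_digraph assms(3,4,5)] assms(6) by simp
  show ?thesis
  proof (rule spanning_treeI)
    show "insert e (T - {z}) \<subseteq> arcs G" using assms T by auto
    show "connected_by G (insert e (T - {z}))"
    proof (rule connected_byI[OF wf_digraph])
      fix x :: "'a \<Rightarrow> int" and u v
      assume x: "\<And>a. a \<in> insert e (T - {z}) \<inter> arcs G \<Longrightarrow> dif G x a = 0" and uv: "u \<in> verts G" "v \<in> verts G"
      have "dif G x e = (\<Sum>t\<in>T. dif G x t * cut G (X t) e)"
        by (rule tree_expansion[OF wf_digraph T(1) finT X assms(3)])
      also have "\<dots> = (\<Sum>t\<in>T. if t = z then dif G x z * cut G (X z) e else 0)"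
        using x T by (intro sum.cong) auto
      finally have "dif G x z * cut G (X z) e = 0" using x[of e] assms finT by simp
      then have "dif G x a = 0" if "a \<in> T \<inter> arcs G" for a using that z x[of a] by (cases "a = z") auto
      then show "x u = x v" using connected_by_const[OF T(1)] uv by blast
    qed
    fix t assume t: "t \<in> insert e (T - {z})"
    show "\<exists>x. dif G x t \<noteq> 0 \<and> (\<forall>t'\<in>insert e (T - {z}) - {t}. dif G x t' = 0)"
    proof (cases "t = e")
      case True
      then show ?thesis using z d assms(5) by (intro exI[of _ "\<lambda>v. of_bool (v \<in> X z)"]) auto
    next
      case False
      \<comment> \<open>The pivot operation: row \<open>t\<close> is combined with row
        \<open>z\<close> so that the entry at the new tree edge \<open>e\<close> cancels.\<close>
      let ?x = "\<lambda>v. cut G (X z) e * of_bool (v \<in> X t) - cut G (X t) e * of_bool (v \<in> X z)"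
      have "dif G ?x a = cut G (X z) e * cut G (X t) a - cut G (X t) e * cut G (X z) a" for a
        unfolding dif_diff dif_scale ..
      then show ?thesis using False t z d assms(5) by (intro exI[of _ ?x]) auto
    qed
  qed
qed

subsection \<open>Deletion and contraction\<close>

lemma dif_restrict [simp]: "dif (restrict_arcs G S) x e = dif G x e"
  by (simp add: dif_def restrict_arcs_def)

lemma verts_restrict [simp]: "verts (restrict_arcs G S) = verts G"
  and arcs_restrict [simp]: "arcs (restrict_arcs G S) = arcs G \<inter> S"
  by (simp_all add: restrict_arcs_def)

lemma fin_digraph_restrict: "fin_digraph G \<Longrightarrow> fin_digraph (restrict_arcs G S)"
  by (auto simp: fin_digraph_def fin_digraph_axioms_def wf_digraph_def restrict_arcs_def)

lemma spanning_tree_restrict: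
  assumes "wf_digraph G" "spanning_tree G T" "T \<subseteq> S"
  shows "spanning_tree (restrict_arcs G S) T"
proof (rule spanning_treeI)
  have T: "T \<subseteq> arcs G" "connected_by G T" using assms(2) by (auto simp: spanning_tree_def)
  show "T \<subseteq> arcs (restrict_arcs G S)" using T assms by auto
  have "ulink (restrict_arcs G S) T = ulink G T"
    using assms(3) unfolding ulink_def restrict_arcs_def by (auto; blast)
  then show "connected_by (restrict_arcs G S) T" using T by (simp add: connected_by_def)
  fix t assume t: "t \<in> T"
  obtain X where "dual_cuts G T X" using spanning_tree_dual_cuts[OF assms(1,2)] .
  then show "\<exists>x. dif (restrict_arcs G S) x t \<noteq> 0 \<and> (\<forall>t'\<in>T - {t}. dif (restrict_arcs G S) x t' = 0)"
    using t by (intro exI[of _ "\<lambda>v. of_bool (v \<in> X t)"]) (auto simp: dual_cuts_def)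
qed

definition merge :: "('v,'e) pre_digraph \<Rightarrow> 'e \<Rightarrow> 'v \<Rightarrow> 'v" where
  "merge G p v = (if v = head G p then tail G p else v)"

lemma contract_arc_simps [simp]:
  "verts (contract_arc G p) = merge G p ` verts G"
  "arcs (contract_arc G p) = arcs G - {p}"
  "tail (contract_arc G p) e = merge G p (tail G e)"
  "head (contract_arc G p) e = merge G p (head G e)"
  by (simp_all add: contract_arc_def Let_def merge_def[abs_def])

lemma dif_contract: "dif (contract_arc G p) x e = dif G (x \<circ> merge G p) e"
  by (simp add: dif_def)

lemma dif_contract_eq: "dif G x p = 0 \<Longrightarrow> dif (contract_arc G p) x e = dif G x e"
  by (auto simp: dif_def merge_def)

lemma fin_digraph_contract: "fin_digraph G \<Longrightarrow> fin_digraph (contract_arc G p)"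
  by (auto simp: fin_digraph_def fin_digraph_axioms_def wf_digraph_def)

text \<open>Potentials on the contraction pull back along \<open>merge\<close> to potentials whose
  coboundary is 0 at \<open>p\<close>, and cuts of the other tree edges, being 0 at
  \<open>p\<close>, descend unchanged.\<close>

lemma spanning_tree_contract:
  assumes "wf_digraph G" "spanning_tree G T" "p \<in> T"
  shows "spanning_tree (contract_arc G p) (T - {p})"
proof (rule spanning_treeI)
  interpret wf_digraph G by fact
  have T: "T \<subseteq> arcs G" "connected_by G T" using assms(2) by (auto simp: spanning_tree_def)
  show "T - {p} \<subseteq> arcs (contract_arc G p)" using T by auto
  show "connected_by (contract_arc G p) (T - {p})"
  proof (rule connected_byI)
    show "wf_digraph (contract_arc G p)" by (auto simp: wf_digraph_def)
    fix x :: "'a \<Rightarrow> int" and u v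
    assume x: "\<And>e. e \<in> (T - {p}) \<inter> arcs (contract_arc G p) \<Longrightarrow> dif (contract_arc G p) x e = 0"
      and uv: "u \<in> verts (contract_arc G p)" "v \<in> verts (contract_arc G p)"
    have "dif G (x \<circ> merge G p) p = 0" by (simp add: dif_def merge_def)
    with x have "dif G (x \<circ> merge G p) e = 0" if "e \<in> T \<inter> arcs G" for e
      using that unfolding dif_contract by (cases "e = p") auto
    then show "x u = x v" using connected_by_const[OF T(2), of "x \<circ> merge G p"] uv by auto
  qed
  fix t assume t: "t \<in> T - {p}"
  obtain X where "dual_cuts G T X" using spanning_tree_dual_cuts[OF assms(1,2)] .
  then have X: "cut G (X t) t' = of_bool (t = t')" if "t' \<in> T" for t'
    using that t unfolding dual_cuts_def by blast
  then have "cut (contract_arc G p) (X t) e = cut G (X t) e" for e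
    using t assms(3) by (intro dif_contract_eq) auto
  then show "\<exists>x. dif (contract_arc G p) x t \<noteq> 0 \<and> (\<forall>t'\<in>T - {p} - {t}. dif (contract_arc G p) x t' = 0)"
    using X t by (intro exI[of _ "\<lambda>v. of_bool (v \<in> X t)"]) auto
qed

text \<open>The intersection is needed because the head of \<open>p\<close> may no longer be a
  vertex after contraction.\<close>

lemma cut_contract:
  assumes "wf_digraph G" "cut G X p = 0" "e \<in> arcs G"
  shows "cut (contract_arc G p) (X \<inter> verts (contract_arc G p)) e = cut G X e"
proof -
  interpret wf_digraph G by fact
  have "cut (contract_arc G p) (X \<inter> verts (contract_arc G p)) e = cut (contract_arc G p) X e"
    using assms(3) by (simp add: dif_def)
  then show ?thesis using dif_contract_eq[OF assms(2)] by simp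
qed

subsection \<open>The lexicographically smallest spanning tree\<close>

lemma sorted_list_of_set_split:
  fixes S :: "'a::linorder set"
  assumes "finite S"
  shows "sorted_list_of_set S = sorted_list_of_set {a\<in>S. a < f} @ sorted_list_of_set {a\<in>S. \<not> a < f}"
proof -
  have S: "S = {a\<in>S. a < f} \<union> {a\<in>S. \<not> a < f}" by auto
  have "sorted_list_of_set ({a\<in>S. a < f} \<union> {a\<in>S. \<not> a < f}) =
     sorted_list_of_set {a\<in>S. a < f} @ sorted_list_of_set {a\<in>S. \<not> a < f}"
    using assms by (intro sorted_distinct_set_unique) (auto simp: sorted_append)
  then show ?thesis using S by simp
qed

text \<open>Both lists share the elements below \<open>f\<close>; then \<open>f\<close> meets the
  next element of \<open>L\<close>, which exists because of \<open>z\<close> and exceeds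
  \<open>f\<close>.\<close>

lemma sorted_list_exchange_less:
  fixes L :: "'a::linorder set"
  assumes "finite L" "z \<in> L" "f \<notin> L" "f < z"
  shows "sorted_list_of_set (insert f (L - {z})) < sorted_list_of_set L"
proof -
  let ?L = "insert f (L - {z})"
  let ?H = "{a \<in> L. \<not> a < f}" and ?A = "{a \<in> L. a < f}"
  have A: "{a\<in>?L. a < f} = ?A" using assms by auto
  have H: "{a\<in>?L. \<not> a < f} = insert f (?H - {z})" by auto
  have "Min (insert f (?H - {z})) = f" using assms(1) by (intro Min_eqI) auto
  then have "sorted_list_of_set (insert f (?H - {z})) = f # sorted_list_of_set (insert f (?H - {z}) - {f})"
    using assms(1) sorted_list_of_set_nonempty[of "insert f (?H - {z})"] by simp
  moreover have "insert f (?H - {z}) - {f} = ?H - {z}" using assms(3) by auto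
  ultimately have "sorted_list_of_set (insert f (?H - {z})) = f # sorted_list_of_set (?H - {z})" by simp
  then have 1: "sorted_list_of_set ?L = sorted_list_of_set ?A @ f # sorted_list_of_set (?H - {z})"
    using sorted_list_of_set_split[of ?L f] assms(1) unfolding A H by simp
  have z: "z \<in> ?H" using assms by auto
  then obtain h t where ht: "sorted_list_of_set ?H = h # t"
    using assms(1) by (cases "sorted_list_of_set ?H") (auto simp: set_sorted_list_of_set)
  then have "h \<in> ?H" using set_sorted_list_of_set[of ?H] assms(1) by auto
  then have "f < h" using assms(3) by (metis (mono_tags) mem_Collect_eq not_less_iff_gr_or_eq)
  then show ?thesis
    using sorted_list_of_set_split[of L f] assms(1) unfolding 1 ht list_less_def
    by (auto intro!: lexord_append_leftI)
qed

lemma lex_min_tree_props: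
  fixes G :: "('v,'e::linorder) pre_digraph"
  assumes "fin_digraph G" "spanning_tree G T"
  shows "spanning_tree G (lex_min_tree G)"
    "spanning_tree G T' \<Longrightarrow> \<not> sorted_list_of_set T' < sorted_list_of_set (lex_min_tree G)"
proof -
  interpret fin_digraph G by fact
  let ?S = "{T. spanning_tree G T}"
  have finT: "finite T" if "spanning_tree G T" for T
    using that finite_subset[of T "arcs G"] by (simp add: spanning_tree_def)
  have inj: "T1 = T2" if "spanning_tree G T1" "spanning_tree G T2" "sorted_list_of_set T1 = sorted_list_of_set T2" for T1 T2
    using that finT by (metis set_sorted_list_of_set)
  have "finite ?S" by (rule finite_subset[of _ "Pow (arcs G)"]) (auto simp: spanning_tree_def)
  then obtain L where L: "is_arg_min sorted_list_of_set (\<lambda>T. T \<in> ?S) L"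
    using ex_is_arg_min_if_finite[of ?S sorted_list_of_set] assms(2) by blast
  then have L1: "spanning_tree G L" and L2: "\<And>T. spanning_tree G T \<Longrightarrow> \<not> sorted_list_of_set T < sorted_list_of_set L"
    unfolding is_arg_min_def by auto
  have "lex_min_tree G = L" unfolding lex_min_tree_def list_less_def[symmetric]
  proof (rule the_equality)
    show "spanning_tree G L \<and> (\<forall>T'. spanning_tree G T' \<and> T' \<noteq> L \<longrightarrow> sorted_list_of_set L < sorted_list_of_set T')"
      using L1 L2 inj by (metis linorder_neqE)
    then show "\<And>T. spanning_tree G T \<and> (\<forall>T'. spanning_tree G T' \<and> T' \<noteq> T \<longrightarrow> sorted_list_of_set T < sorted_list_of_set T') \<Longrightarrow> T = L"
      by (metis less_asym)
  qed
  then show "spanning_tree G (lex_min_tree G)"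
    "spanning_tree G T' \<Longrightarrow> \<not> sorted_list_of_set T' < sorted_list_of_set (lex_min_tree G)"
    using L1 L2 by auto
qed

text \<open>Otherwise the fundamental cycle of \<open>f\<close> meets the support of the coboundary
  in a second edge \<open>z\<close>, which exceeds \<open>f\<close> by the choice of
  \<open>f\<close>, and exchanging \<open>z\<close> for \<open>f\<close> yields a smaller
  tree.\<close>

lemma min_dif_in_lex_min_tree:
  fixes G :: "('v,'e::linorder) pre_digraph"
  assumes G: "fin_digraph G" "spanning_tree G T"
    and f: "f \<in> arcs G" "dif G x f \<noteq> 0" "\<And>e. e \<in> arcs G \<Longrightarrow> e < f \<Longrightarrow> dif G x e = 0"
  shows "f \<in> lex_min_tree G"
proof (rule ccontr)
  interpret fin_digraph G by fact
  let ?L = "lex_min_tree G"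
  assume fL: "f \<notin> ?L"
  have L: "spanning_tree G ?L" using lex_min_tree_props(1)[OF G] .
  obtain X where X: "dual_cuts G ?L X" using spanning_tree_dual_cuts[OF wf_digraph L] .
  note Z = fund_cycle_props[OF L X wf_digraph f(1) fL]
  obtain z where z: "z \<in> supp (fund_cycle G ?L f)" "z \<noteq> f" "dif G x z \<noteq> 0"
    using signed_cycle_not_single[OF Z(1), of f x] Z(3) f(2) by (auto simp: supp_def)
  then have zL: "z \<in> ?L" "z \<in> arcs G" using Z(2) L by (auto simp: spanning_tree_def)
  then have "f < z" using f(3)[of z] z by force
  then have "sorted_list_of_set (insert f (?L - {z})) < sorted_list_of_set ?L"
    using zL fL finite_subset[of ?L "arcs G"] L
    by (intro sorted_list_exchange_less) (auto simp: spanning_tree_def)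
  then show False
    using lex_min_tree_props(2)[OF G] spanning_tree_exchange[OF G(1) L f(1) fL zL(1) z(1)] by blast
qed

subsection \<open>Lexicographic signs\<close>

text \<open>Strict negativity in the lexicographic order on integer vectors indexed by
  \<open>S\<close>. The cocycle order and the cocycle half of full optimality both reduce to
  it.\<close>

definition first_neg :: "'e::linorder set \<Rightarrow> ('e \<Rightarrow> int) \<Rightarrow> bool" where
  "first_neg S d \<longleftrightarrow> (\<exists>f\<in>S. d f < 0 \<and> (\<forall>e\<in>S. e < f \<longrightarrow> d e = 0))"

lemma first_neg_iff_Min:
  assumes "finite S"
  shows "first_neg S d \<longleftrightarrow> {e\<in>S. d e \<noteq> 0} \<noteq> {} \<and> d (Min {e\<in>S. d e \<noteq> 0}) < 0"
proof
  assume "first_neg S d"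
  then obtain f where f: "f \<in> S" "d f < 0" "\<forall>e\<in>S. e < f \<longrightarrow> d e = 0" unfolding first_neg_def by blast
  then have "Min {e\<in>S. d e \<noteq> 0} = f" using assms by (intro Min_eqI) force+
  with f show "{e\<in>S. d e \<noteq> 0} \<noteq> {} \<and> d (Min {e\<in>S. d e \<noteq> 0}) < 0" by auto
next
  let ?A = "{e\<in>S. d e \<noteq> 0}"
  assume A: "?A \<noteq> {} \<and> d (Min ?A) < 0"
  have "finite ?A" using assms by simp
  then have "Min ?A \<in> ?A" "\<And>e. e \<in> ?A \<Longrightarrow> Min ?A \<le> e" using A Min_in[of ?A] Min_le[of ?A] by blast+
  with A show "first_neg S d" unfolding first_neg_def by (metis (mono_tags, lifting) leD mem_Collect_eq)
qed

lemma first_neg_cong: "(\<And>e. e \<in> S \<Longrightarrow> d e = d' e) \<Longrightarrow> first_neg S d \<longleftrightarrow> first_neg S d'"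
  unfolding first_neg_def by auto

lemma first_neg_trichotomy:
  assumes "finite S"
  shows "(\<forall>e\<in>S. d e = 0) \<or> first_neg S d \<or> first_neg S (\<lambda>e. - d e)"
proof (cases "{e\<in>S. d e \<noteq> 0} = {}")
  case False
  then have "Min {e\<in>S. d e \<noteq> 0} \<in> {e\<in>S. d e \<noteq> 0}" using assms by (intro Min_in) auto
  then show ?thesis using False unfolding first_neg_iff_Min[OF assms] by auto
qed auto

lemma first_neg_asym:
  assumes "first_neg S d"
  shows "\<not> first_neg S (\<lambda>e. - d e)"
proof
  assume "first_neg S (\<lambda>e. - d e)"
  then obtain g where g: "g \<in> S" "d g > 0" "\<forall>e\<in>S. e < g \<longrightarrow> d e = 0" unfolding first_neg_def by auto
  obtain f where f: "f \<in> S" "d f < 0" "\<forall>e\<in>S. e < f \<longrightarrow> d e = 0" using assms unfolding first_neg_def by blast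
  show False using f g by (cases f g rule: linorder_cases) auto
qed

lemma first_neg_add:
  assumes "first_neg S a" "first_neg S b"
  shows "first_neg S (\<lambda>e. a e + b e)"
proof -
  obtain f where f: "f \<in> S" "a f < 0" "\<forall>e\<in>S. e < f \<longrightarrow> a e = 0" using assms unfolding first_neg_def by blast
  obtain g where g: "g \<in> S" "b g < 0" "\<forall>e\<in>S. e < g \<longrightarrow> b e = 0" using assms unfolding first_neg_def by blast
  show ?thesis unfolding first_neg_def
  proof (intro bexI[of _ "min f g"] conjI ballI impI)
    show "a (min f g) + b (min f g) < 0" "min f g \<in> S"
      using f g by (cases f g rule: linorder_cases; simp add: min_def)+
  qed (use f g in auto)
qed

lemma first_neg_sum:
  assumes "finite A" "A \<noteq> {}" "\<And>i. i \<in> A \<Longrightarrow> first_neg S (d i)"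
  shows "first_neg S (\<lambda>e. \<Sum>i\<in>A. d i e)"
  using assms
proof (induction A rule: finite_ne_induct)
  case (insert i A)
  then show ?case using first_neg_add[of S "d i" "\<lambda>e. \<Sum>i\<in>A. d i e"] by simp
qed simp

section \<open>Cocycle order and full optimality as lexicographic sign conditions\<close>

lemma supp_cut: "supp (out_cut G X, in_cut G X) = {e \<in> arcs G. cut G X e \<noteq> 0}"
  unfolding supp_def by (auto simp only: set_eq_iff mem_cut_supp_iff fst_conv snd_conv mem_Collect_eq)

text \<open>The set in \<open>cocycle_greater\<close> is where the two vectors differ; with entries
  in -1, 0, 1, the first is larger at such a place exactly if it is positive there or the second is
  negative.\<close>

lemma cocycle_greater_iff:
  assumes "finite F" "F \<subseteq> arcs G"
  shows "cocycle_greater F (out_cut G X, in_cut G X) (out_cut G Y, in_cut G Y) \<longleftrightarrow>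
    first_neg F (\<lambda>e. cut G Y e - cut G X e)"
proof -
  let ?C = "(out_cut G X, in_cut G X)" and ?D = "(out_cut G Y, in_cut G Y)"
  let ?S = "{f\<in>F. cut G Y f - cut G X f \<noteq> 0}"
  have "f \<in> (supp ?C - supp ?D) \<union> (supp ?D - supp ?C) \<or> f \<in> fst ?C \<inter> snd ?D \<or> f \<in> snd ?C \<inter> fst ?D \<longleftrightarrow>
      cut G Y f - cut G X f \<noteq> 0" if "f \<in> F" for f
    using that assms(2) cut_cases[of G X f] cut_cases[of G Y f]
    unfolding supp_cut by (auto simp: mem_out_cut_iff mem_in_cut_iff)
  then have S: "{f \<in> F. f \<in> (supp ?C - supp ?D) \<union> (supp ?D - supp ?C) \<or>
      f \<in> fst ?C \<inter> snd ?D \<or> f \<in> snd ?C \<inter> fst ?D} = ?S"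
    by (intro Collect_cong conj_cong refl)
  have "Min ?S \<in> fst ?C \<or> Min ?S \<in> snd ?D \<longleftrightarrow> cut G Y (Min ?S) - cut G X (Min ?S) < 0" if "?S \<noteq> {}"
  proof -
    have "Min ?S \<in> ?S" using that assms(1) by (intro Min_in) auto
    then have "Min ?S \<in> arcs G" "cut G Y (Min ?S) \<noteq> cut G X (Min ?S)" using assms(2) by auto
    then show ?thesis using cut_cases[of G X "Min ?S"] cut_cases[of G Y "Min ?S"]
      unfolding fst_conv snd_conv mem_out_cut_iff mem_in_cut_iff by auto
  qed
  then show ?thesis unfolding cocycle_greater_def S Let_def first_neg_iff_Min[OF assms(1)] by blast
qed

text \<open>As \<open>b\<close> is positive in its cocycle, opposite signs mean that row
  \<open>b\<close> starts negatively. As \<open>e\<close> is positive in its cycle and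
  \<open>cycle_signs\<close> reverses signs, the cycle condition says that column \<open>e\<close>
  starts with 1, in the row of an edge smaller than \<open>e\<close>.\<close>

lemma fully_optimal_iff:
  fixes G :: "('v,'e::linorder) pre_digraph"
  assumes G: "fin_digraph G" and T: "spanning_tree G T" and X: "dual_cuts G T X"
  shows "fully_optimal G T \<longleftrightarrow>
    (\<forall>b\<in>T - {Min (arcs G)}. first_neg (arcs G) (cut G (X b))) \<and>
    (\<forall>e\<in>arcs G - T. \<exists>t\<in>T. t < e \<and> cut G (X t) e = 1 \<and> (\<forall>t'\<in>T. t' < t \<longrightarrow> cut G (X t') e = 0))"
proof -
  interpret fin_digraph G by fact
  have TA: "T \<subseteq> arcs G" using T by (simp add: spanning_tree_def)
  have cocycle: "opposite_signs (fund_cocycle G T b) b (Min (supp (fund_cocycle G T b))) \<longleftrightarrow>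
    first_neg (arcs G) (cut G (X b))" if b: "b \<in> T" for b
  proof -
    let ?A = "{e \<in> arcs G. cut G (X b) e \<noteq> 0}"
    have cb: "cut G (X b) b = 1" using X b unfolding dual_cuts_def by auto
    then have "b \<in> ?A" using b TA by auto
    then have ne: "?A \<noteq> {}" by blast
    then have "Min ?A \<in> ?A" by (intro Min_in) auto
    then show ?thesis
      using cb b TA cut_cases[of G "X b" "Min ?A"] ne
      unfolding fund_cocycle_eq[OF wf_digraph T X b] supp_cut first_neg_iff_Min[OF finite_arcs]
        opposite_signs_def fst_conv snd_conv mem_out_cut_iff mem_in_cut_iff by auto
  qed
  have cycle: "opposite_signs (fund_cycle G T e) e (Min (supp (fund_cycle G T e))) \<longleftrightarrow>
    (\<exists>t\<in>T. t < e \<and> cut G (X t) e = 1 \<and> (\<forall>t'\<in>T. t' < t \<longrightarrow> cut G (X t') e = 0))"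
    (is "?L \<longleftrightarrow> ?R") if e: "e \<in> arcs G" "e \<notin> T" for e
  proof -
    let ?Z = "fund_cycle G T e"
    note Z = fund_cycle_props[OF T X wf_digraph e]
    note memZ = mem_supp_fund_cycle_iff[OF T X wf_digraph e]
    have eZ: "e \<notin> snd ?Z" "e \<in> supp ?Z" using Z(3) signed_cycle_basic(4)[OF Z(1)] by (auto simp: supp_def)
    have finZ: "finite (supp ?Z)" using signed_cycle_basic(3)[OF Z(1)] .
    let ?m = "Min (supp ?Z)"
    have L: "?L \<longleftrightarrow> ?m \<in> snd ?Z" unfolding opposite_signs_def using eZ Z(3) by auto
    have m: "?m \<in> supp ?Z" "\<And>a. a \<in> supp ?Z \<Longrightarrow> ?m \<le> a" using finZ eZ(2) by (auto intro: Min_in)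
    show ?thesis
    proof
      assume ?L
      then have ms: "?m \<in> snd ?Z" using L by simp
      then have "?m \<noteq> e" using eZ by auto
      then have mT: "?m \<in> T" "?m < e" using m(1) m(2)[OF eZ(2)] Z(2) by auto
      have "cut G (X t') e = 0" if "t' \<in> T" "t' < ?m" for t'
        using memZ[OF that(1)] m(2)[of t'] that(2) by force
      then show ?R using Z(5)[OF mT(1)] ms mT by blast
    next
      assume ?R
      then obtain t where t: "t \<in> T" "t < e" "cut G (X t) e = 1" "\<forall>t'\<in>T. t' < t \<longrightarrow> cut G (X t') e = 0" by blast
      then have ts: "t \<in> snd ?Z" using Z(5) by simp
      have "?m = t"
      proof (rule Min_eqI[OF finZ])
        fix a assume a: "a \<in> supp ?Z"
        then have "a = e \<or> a \<in> T" using Z(2) by auto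
        then show "t \<le> a" using t memZ[of a] a by force
      qed (use ts in \<open>auto simp: supp_def\<close>)
      then show ?L using L ts by simp
    qed
  qed
  show ?thesis unfolding fully_optimal_def using T cocycle cycle by auto
qed

subsection \<open>Correctness of the algorithm\<close>

text \<open>The matrix \<open>M\<close> of the dual cuts of the optimal tree does not change under the deletions and
contractions of the algorithm; its rows \<open>t\<close> with \<open>t \<in> T\<close> stay the fundamental cocycles of the
part \<open>T\<close> of the tree that is not yet contracted.\<close>
definition alg_inv :: "('e \<Rightarrow> 'e \<Rightarrow> int) \<Rightarrow> ('v,'e::linorder) pre_digraph \<Rightarrow> 'e \<Rightarrow> 'e set \<Rightarrow> 'e set \<Rightarrow> 'e set \<Rightarrow> bool" where
  "alg_inv M G p E F T \<longleftrightarrow>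
     fin_digraph G \<and> spanning_tree G T \<and> spanning_tree G (insert p F) \<and> p \<notin> F \<and> p \<in> T \<and> T \<subseteq> E \<and>
     p = Min E \<and> arcs G = E \<union> F \<and>
     (\<forall>t\<in>T. \<exists>X\<subseteq>verts G. \<forall>e\<in>arcs G. cut G X e = M t e) \<and>
     (\<forall>t\<in>T. \<forall>t'\<in>T. M t t' = of_bool (t = t')) \<and>
     (\<forall>e\<in>E - T. \<exists>t\<in>T. t < e \<and> M t e = 1 \<and> (\<forall>t'\<in>T. t' < t \<longrightarrow> M t' e = 0)) \<and>
     (\<forall>b\<in>T - {p}. first_neg F (M b))"

locale alg_state =
  fixes M and G :: "('v,'e::linorder) pre_digraph" and p E F T
  assumes inv: "alg_inv M G p E F T"
begin

lemma fin: "fin_digraph G" and tree: "spanning_tree G T" and treeF: "spanning_tree G (insert p F)"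
  and p: "p \<notin> F" "p \<in> T" and TE: "T \<subseteq> E" and p_Min: "p = Min E" and arcs_eq: "arcs G = E \<union> F"
  and M_tree: "\<And>t t'. t \<in> T \<Longrightarrow> t' \<in> T \<Longrightarrow> M t t' = of_bool (t = t')"
  and dual: "\<And>e. e \<in> E \<Longrightarrow> e \<notin> T \<Longrightarrow> \<exists>t\<in>T. t < e \<and> M t e = 1 \<and> (\<forall>t'\<in>T. t' < t \<longrightarrow> M t' e = 0)"
  and primal: "\<And>b. b \<in> T \<Longrightarrow> b \<noteq> p \<Longrightarrow> first_neg F (M b)"
  using inv unfolding alg_inv_def by auto

sublocale fin_digraph G by (rule fin)

lemma conn: "connected_by G T" using tree by (simp add: spanning_tree_def)

lemma finites: "finite E" "finite F" "finite T"
  using finite_arcs TE arcs_eq by (auto intro: finite_subset)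

lemma p_le: "e \<in> E \<Longrightarrow> p \<le> e"
  using p_Min finites by simp

lemma M_cut: "t \<in> T \<Longrightarrow> \<exists>X\<subseteq>verts G. \<forall>e\<in>arcs G. cut G X e = M t e"
  using inv unfolding alg_inv_def by blast

text \<open>The vertex sets are chosen afresh in each state, since contraction changes the vertices
  while \<open>M\<close> stays fixed.\<close>

definition X where "X t = (SOME X. X \<subseteq> verts G \<and> (\<forall>e\<in>arcs G. cut G X e = M t e))"

lemma X: assumes "t \<in> T"
  shows "X t \<subseteq> verts G" "e \<in> arcs G \<Longrightarrow> cut G (X t) e = M t e"
  using someI_ex[OF M_cut[OF assms, folded subset_eq]] unfolding X_def by blast+

lemma dual_cuts_X: "dual_cuts G T X"
  unfolding dual_cuts_def using X M_tree TE arcs_eq by auto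

lemma cut_expansion:
  assumes "e \<in> arcs G"
  shows "dif G x e = (\<Sum>t\<in>T. dif G x t * M t e)"
  using tree_expansion[OF wf_digraph conn finites(3) dual_cuts_X assms, of x] X(2)[OF _ assms] by simp

text \<open>Row \<open>p\<close> is the topmost one, so a nonzero entry there is the first of its
  column, which is 1. Hence \<open>M p\<close> is directed on \<open>E\<close>.\<close>

lemma M_p_ground:
  assumes "e \<in> E" "M p e \<noteq> 0"
  shows "M p e = 1"
proof (cases "e \<in> T")
  case True
  then show ?thesis using M_tree[OF p(2) True] assms(2) by (simp split: if_splits)
next
  case False
  then obtain t where t: "t \<in> T" "M t e = 1" "\<forall>t'\<in>T. t' < t \<longrightarrow> M t' e = 0" using dual assms(1) by blast
  then have "\<not> p < t" using assms(2) p by blast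
  then have "t = p" using p_le[of t] t(1) TE by force
  with t show ?thesis by simp
qed

lemma greater_candidate:
  assumes Y: "p \<in> out_cut G Y" "supp (out_cut G Y, in_cut G Y) \<inter> E \<subseteq> out_cut G Y"
    and ne: "(out_cut G Y, in_cut G Y) \<noteq> (out_cut G (X p), in_cut G (X p))"
  shows "first_neg F (\<lambda>e. cut G Y e - cut G (X p) e)"
proof -
  \<comment> \<open>Since \<open>T\<close> lies in \<open>E\<close>, a candidate is positive on
    every tree edge it contains; its coordinates along \<open>T\<close> are 0 or 1.\<close>
  have Y01: "cut G Y t = of_bool (cut G Y t = 1)" if "t \<in> T" for t
  proof (cases "cut G Y t = 0")
    case False
    then have "t \<in> supp (out_cut G Y, in_cut G Y) \<inter> E" unfolding supp_cut using that TE arcs_eq by auto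
    then have "t \<in> out_cut G Y" using Y(2) by blast
    then show ?thesis unfolding mem_out_cut_iff by simp
  qed simp
  have Yp: "cut G Y p = 1" using Y(1) unfolding mem_out_cut_iff by simp
  let ?A = "{t\<in>T. cut G Y t = 1} - {p}"
  have eq: "cut G Y e - cut G (X p) e = (\<Sum>t\<in>?A. M t e)" if "e \<in> arcs G" for e
  proof -
    have "cut G Y e = (\<Sum>t\<in>T. cut G Y t * M t e)" using cut_expansion that by blast
    also have "\<dots> = (\<Sum>t\<in>T. if cut G Y t = 1 then M t e else 0)"
      by (rule sum.cong[OF refl]) (use Y01 in force)
    also have "\<dots> = (\<Sum>t\<in>{t\<in>T. cut G Y t = 1}. M t e)"
      by (rule sum.inter_filter[symmetric]) (rule finites)
    also have "\<dots> = M p e + (\<Sum>t\<in>?A. M t e)"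
      by (rule sum.remove) (use finites Yp p in auto)
    finally show ?thesis using X(2)[OF p(2) that] by simp
  qed
  have "?A \<noteq> {}"
  proof
    assume "?A = {}"
    then have "(\<Sum>t\<in>?A. M t e) = 0" for e by (simp only: sum.empty)
    then have "cut G Y e = cut G (X p) e" if "e \<in> arcs G" for e using eq[OF that] by simp
    then show False using ne cut_eq_imp_eq[of G Y "X p"] by simp
  qed
  then have "first_neg F (\<lambda>e. \<Sum>t\<in>?A. M t e)"
    using finites primal by (intro first_neg_sum) auto
  then show ?thesis using first_neg_cong[of F "\<lambda>e. cut G Y e - cut G (X p) e" "\<lambda>e. \<Sum>t\<in>?A. M t e"] eq arcs_eq
    by simp
qed

lemma optimal_cocycle_eq: "optimal_cocycle G p E F = (out_cut G (X p), in_cut G (X p))"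
  unfolding optimal_cocycle_def
proof (rule the_equality)
  let ?C = "(out_cut G (X p), in_cut G (X p))"
  have pA: "p \<in> arcs G" using p TE arcs_eq by auto
  have greater: "cocycle_greater F ?C D" if D: "opt_candidate G p E D" "D \<noteq> ?C" for D
  proof -
    obtain Y where Y: "D = (out_cut G Y, in_cut G Y)"
      using D unfolding opt_candidate_def signed_cocycle_def by (metis prod.collapse)
    then show ?thesis
      using greater_candidate[of Y] D cocycle_greater_iff[of F G "X p" Y] finites arcs_eq
      unfolding opt_candidate_def by simp
  qed
  have "signed_cocycle G ?C"
    by (rule signed_cocycle_cut[OF wf_digraph conn X(1)[OF p(2)] p(2) pA])
      (use X(2)[OF p(2)] M_tree[OF p(2)] p TE arcs_eq in auto)
  moreover have "p \<in> out_cut G (X p)" unfolding mem_out_cut_iff using X(2)[OF p(2) pA] M_tree p pA by simp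
  moreover have "supp ?C \<inter> E \<subseteq> out_cut G (X p)"
  proof
    fix e assume "e \<in> supp ?C \<inter> E"
    then have "e \<in> arcs G" "e \<in> E" "M p e \<noteq> 0" unfolding supp_cut using X(2)[OF p(2)] by auto
    then show "e \<in> out_cut G (X p)" unfolding mem_out_cut_iff using M_p_ground X(2)[OF p(2)] by simp
  qed
  ultimately have cand: "opt_candidate G p E ?C" unfolding opt_candidate_def by simp
  show "opt_candidate G p E ?C \<and> (\<forall>D. opt_candidate G p E D \<and> D \<noteq> ?C \<longrightarrow> cocycle_greater F ?C D)"
    using cand greater by blast
  fix D assume D: "opt_candidate G p E D \<and> (\<forall>D'. opt_candidate G p E D' \<and> D' \<noteq> D \<longrightarrow> cocycle_greater F D D')"
  obtain Y where Y: "D = (out_cut G Y, in_cut G Y)"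
    using D unfolding opt_candidate_def signed_cocycle_def by (metis prod.collapse)
  show "D = ?C"
  proof (rule ccontr)
    assume ne: "D \<noteq> ?C"
    have F: "finite F" "F \<subseteq> arcs G" using finites arcs_eq by auto
    have "first_neg F (\<lambda>e. cut G Y e - cut G (X p) e)" "first_neg F (\<lambda>e. cut G (X p) e - cut G Y e)"
      using greater[of D] D cand ne Y cocycle_greater_iff[OF F, of "X p" Y] cocycle_greater_iff[OF F, of Y "X p"]
      by auto
    then show False using first_neg_asym[of F "\<lambda>e. cut G Y e - cut G (X p) e"] by simp
  qed
qed

text \<open>Synchronises the loop, which is counted by \<open>F\<close>, with \<open>T\<close>, from
  which the output is taken.\<close>

lemma objective_empty_iff: "F = {} \<longleftrightarrow> T = {p}"
proof
  assume "F = {}"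
  then show "T = {p}" using primal p unfolding first_neg_def by blast
next
  assume T: "T = {p}"
  show "F = {}"
  proof (rule ccontr)
    assume "F \<noteq> {}"
    then obtain f where f: "f \<in> F" by blast
    obtain Y where "dual_cuts G (insert p F) Y" using spanning_tree_dual_cuts[OF wf_digraph treeF] .
    then have Y: "cut G (Y f) f = 1" "cut G (Y f) p = 0" using f p unfolding dual_cuts_def by auto
    have "cut G (Y f) f = 0"
      by (rule connected_by_dif_eq_0[OF wf_digraph conn]) (use T Y f arcs_eq in auto)
    then show False using Y by simp
  qed
qed

lemma next_state:
  assumes "F \<noteq> {}"
  obtains G' t E' F' where "alg_step (G, p, E, F) = ((G', t, E', F'), t)" "t \<in> T" "t \<noteq> p"
    "alg_inv M G' t E' F' (T - {p})" "card F' = card F - 1"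
proof -
  define E' where "E' = {e\<in>E. M p e = 0}"
  define t where "t = Min E'"
  have E': "E - supp (optimal_cocycle G p E F) = E'"
    unfolding optimal_cocycle_eq supp_cut E'_def using X(2)[OF p(2)] arcs_eq by auto
  have pE': "p \<notin> E'" unfolding E'_def using M_tree[OF p(2,2)] by simp
  have TE': "T - {p} \<subseteq> E'" unfolding E'_def using TE M_tree[OF p(2)] by auto
  have "T \<noteq> {p}" using objective_empty_iff assms by simp
  then have ne: "T - {p} \<noteq> {}" using p by auto
  have finE': "finite E'" unfolding E'_def using finites by simp
  have tE': "t \<in> E'" "\<And>e. e \<in> E' \<Longrightarrow> t \<le> e" unfolding t_def using ne TE' finE' by (auto intro: Min_in)
  have tT: "t \<in> T"
  proof (rule ccontr)
    assume "t \<notin> T"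
    then obtain t' where t': "t' \<in> T" "t' < t" "M t' t = 1" using dual[of t] tE' unfolding E'_def by auto
    then have "t' \<noteq> p" using tE'(1) unfolding E'_def by auto
    then show False using t' TE' tE'(2)[of t'] by force
  qed
  have tp: "t \<noteq> p" using pE' tE' by auto
  have tA: "t \<in> arcs G" using tT TE arcs_eq by auto
  define F' where "F' = (if t \<in> F then F - {t} else F - {Max (F \<inter> supp (fund_cycle G (F \<union> {p}) t))})"
  define G' where "G' = contract_arc (restrict_arcs G (E' \<union> F' \<union> {p})) p"
  have step: "alg_step (G, p, E, F) = ((G', t, E', F'), t)"
    unfolding alg_step_def prod.case Let_def E' t_def[symmetric] F'_def[symmetric] G'_def[symmetric] ..
  \<comment> \<open>The new objective tree is checked before the contraction, hence still with
    \<open>p\<close>.\<close>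
  have "spanning_tree G (insert p (insert t F')) \<and> F' \<subseteq> F \<and> t \<notin> F' \<and> card F' = card F - 1 \<and>
    (\<forall>b\<in>T - {p} - {t}. first_neg F' (M b))"
  proof (cases "t \<in> F")
    case True
    then have F': "F' = F - {t}" unfolding F'_def by simp
    have "first_neg F' (M b)" if b: "b \<in> T - {p} - {t}" for b
    proof -
      \<comment> \<open>Row \<open>b\<close> is 0 at \<open>t\<close>, so its first nonzero entry on
        \<open>F\<close> is not at the dropped edge.\<close>
      have "M b t = 0" using M_tree b tT by auto
      moreover have "first_neg F (M b)" using primal b by auto
      ultimately show ?thesis unfolding first_neg_def F' by force
    qed
    moreover have "insert p (insert t F') = insert p F" using True F' by auto
    ultimately show ?thesis using treeF True finites unfolding F' by auto
  next
    case False
    let ?Z = "fund_cycle G (insert p F) t" and ?S = "F \<inter> supp (fund_cycle G (insert p F) t)"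
    define z where "z = Max ?S"
    have F': "F' = F - {z}" unfolding F'_def z_def using False by simp
    have tF: "t \<notin> insert p F" using False tp by simp
    obtain Y where "dual_cuts G (insert p F) Y" using spanning_tree_dual_cuts[OF wf_digraph treeF] .
    note Z = fund_cycle_props[OF treeF this wf_digraph tA tF]
    have ZA: "supp ?Z \<subseteq> arcs G" using signed_cycle_basic(1)[OF Z(1)] .
    have M0: "M b e = 0" if "b \<in> T" "e \<in> supp ?Z" "\<And>a. a \<in> supp ?Z \<Longrightarrow> a \<noteq> e \<Longrightarrow> M b a = 0" for b e
    proof -
      have "cut G (X b) e = 0"
        by (rule signed_cycle_not_single[OF Z(1) that(2)]) (use X(2)[OF that(1)] that(3) ZA in auto)
      then show ?thesis using X(2)[OF that(1)] that(2) ZA by auto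
    qed
    have tZ: "t \<in> supp ?Z" using Z(3) by (simp add: supp_def)
    \<comment> \<open>Otherwise the cycle consists of \<open>t\<close> and at most \<open>p\<close>,
      and row \<open>t\<close>, which is 0 at \<open>p\<close>, would meet it in \<open>t\<close>
      alone.\<close>
    have "?S \<noteq> {}"
    proof
      assume "?S = {}"
      then have "a = p" if "a \<in> supp ?Z" "a \<noteq> t" for a using that Z(2) by auto
      then have "M t t = 0" using M0[OF tT tZ] M_tree[OF tT p(2)] tp by auto
      then show False using M_tree[OF tT tT] by simp
    qed
    moreover have "finite ?S" using finites by blast
    ultimately have z: "z \<in> ?S" "\<And>a. a \<in> ?S \<Longrightarrow> a \<le> z"
      unfolding z_def using Max_in[of ?S] Max_ge[of ?S] by blast+
    have "first_neg F' (M b)" if b: "b \<in> T - {p} - {t}" for b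
    proof -
      obtain f where f: "f \<in> F" "M b f < 0" "\<forall>e\<in>F. e < f \<longrightarrow> M b e = 0"
        using primal[of b] b unfolding first_neg_def by auto
      \<comment> \<open>This is why the largest edge is dropped: if row \<open>b\<close> first
        became nonzero on \<open>F\<close> at \<open>z\<close>, it would vanish on the smaller
        objective edges of the cycle and on the tree edges \<open>t\<close> and \<open>p\<close>, so
        it would meet the cycle in \<open>z\<close> alone.\<close>
      have "f \<noteq> z"
      proof
        assume fz: "f = z"
        have "M b z = 0"
        proof (rule M0)
          fix a assume a: "a \<in> supp ?Z" "a \<noteq> z"
          then consider "a = t" | "a = p" | "a \<in> ?S" using Z(2) by auto
          then show "M b a = 0"
          proof cases
            case 3
            then show ?thesis using z(2)[of a] a f fz by force
          qed (use M_tree[of b] b tT p in auto)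
        qed (use b z in auto)
        then show False using f fz by simp
      qed
      then show ?thesis using f unfolding first_neg_def F' by auto
    qed
    moreover have "insert p (insert t F') = insert t (insert p F - {z})" using z p F' by auto
    moreover have "spanning_tree G (insert t (insert p F - {z}))"
      by (rule spanning_tree_exchange[OF fin treeF tA tF]) (use z in auto)
    ultimately show ?thesis using False z finites unfolding F' by auto
  qed
  then have treeF': "spanning_tree G (insert p (insert t F'))" and F'F: "F' \<subseteq> F" and tF': "t \<notin> F'"
    and cardF': "card F' = card F - 1" and primal': "\<forall>b\<in>T - {p} - {t}. first_neg F' (M b)"
    by blast+
  let ?R = "restrict_arcs G (E' \<union> F' \<union> {p})"
  have finR: "fin_digraph ?R" using fin_digraph_restrict[OF fin] .
  then have wfR: "wf_digraph ?R" by (simp add: fin_digraph_def)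
  have "spanning_tree ?R T" by (rule spanning_tree_restrict[OF wf_digraph tree]) (use TE' in auto)
  then have tree': "spanning_tree G' (T - {p})" unfolding G'_def using spanning_tree_contract[OF wfR] p by blast
  have "spanning_tree ?R (insert p (insert t F'))"
    by (rule spanning_tree_restrict[OF wf_digraph treeF']) (use tE' in auto)
  then have "spanning_tree G' (insert p (insert t F') - {p})"
    unfolding G'_def using spanning_tree_contract[OF wfR] by blast
  moreover have "insert p (insert t F') - {p} = insert t F'" using tp F'F p by auto
  ultimately have treeF'': "spanning_tree G' (insert t F')" by simp
  have arcs': "arcs G' = E' \<union> F'" unfolding G'_def using arcs_eq pE' F'F p unfolding E'_def by auto
  have cuts: "\<exists>Y\<subseteq>verts G'. \<forall>e\<in>arcs G'. cut G' Y e = M b e" if b: "b \<in> T - {p}" for b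
  proof (intro exI[of _ "X b \<inter> verts G'"] conjI ballI)
    fix e assume e: "e \<in> arcs G'"
    then have eR: "e \<in> arcs ?R" unfolding G'_def by auto
    have "cut ?R (X b) p = 0" using X(2)[of b p] b p TE arcs_eq M_tree[of b p] by auto
    from cut_contract[OF wfR this eR] have "cut G' (X b \<inter> verts G') e = cut G (X b) e" unfolding G'_def by simp
    then show "cut G' (X b \<inter> verts G') e = M b e" using X(2)[of b e] b eR by auto
  qed auto
  have dual': "\<exists>s\<in>T - {p}. s < e \<and> M s e = 1 \<and> (\<forall>t'\<in>T - {p}. t' < s \<longrightarrow> M t' e = 0)" if e: "e \<in> E' - (T - {p})" for e
  proof -
    have "e \<in> E" "e \<notin> T" "M p e = 0" using e pE' unfolding E'_def by auto
    then obtain s where s: "s \<in> T" "s < e" "M s e = 1" "\<forall>t'\<in>T. t' < s \<longrightarrow> M t' e = 0" using dual by blast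
    then have "s \<noteq> p" using \<open>M p e = 0\<close> by auto
    then show ?thesis using s by auto
  qed
  have "alg_inv M G' t E' F' (T - {p})" unfolding alg_inv_def
  proof (intro conjI ballI)
    show "fin_digraph G'" unfolding G'_def by (rule fin_digraph_contract[OF finR])
  qed (use tree' treeF'' tF' tT tp TE' t_def arcs' cuts M_tree dual' primal' in auto)
  then show ?thesis using that step tT tp cardF' by blast
qed

end

section \<open>Running the loop from the initial state\<close>

lemma alg_iter_eq:
  assumes "alg_inv M G p E F T"
  shows "alg_iter (card F) (G, p, E, F) = T - {p}"
  using assms
proof (induction "card F" arbitrary: G p E F T)
  case 0
  interpret alg_state M G p E F T by unfold_locales (rule 0)
  show ?case using 0 objective_empty_iff finites by simp
next
  case (Suc n)
  interpret alg_state M G p E F T by unfold_locales (rule Suc)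
  have "F \<noteq> {}" using Suc.hyps(2) by auto
  then obtain G' t E' F' where step: "alg_step (G, p, E, F) = ((G', t, E', F'), t)" "t \<in> T" "t \<noteq> p"
    "alg_inv M G' t E' F' (T - {p})" "card F' = card F - 1" by (rule next_state)
  then have "n = card F'" using Suc.hyps(2) by simp
  then have "alg_iter n (G', t, E', F') = T - {p} - {t}" using Suc.hyps(1) step(4) by simp
  then show ?case unfolding Suc.hyps(2)[symmetric] using step by auto
qed

lemma alg_output_eq_fully_optimal:
  assumes G: "fin_digraph G" "arcs G \<noteq> {}" and T: "fully_optimal G T"
  shows "alg_output G = T"
proof -
  interpret fin_digraph G by fact
  define p where "p = Min (arcs G)"
  have tree: "spanning_tree G T" using T by (simp add: fully_optimal_def)
  then have TA: "T \<subseteq> arcs G" by (simp add: spanning_tree_def)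
  obtain X where X: "dual_cuts G T X" using spanning_tree_dual_cuts[OF wf_digraph tree] .
  then have XT: "X t \<subseteq> verts G" "t' \<in> T \<Longrightarrow> cut G (X t) t' = of_bool (t = t')" if "t \<in> T" for t t'
    using that unfolding dual_cuts_def by auto
  have opt: "\<And>b. b \<in> T \<Longrightarrow> b \<noteq> p \<Longrightarrow> first_neg (arcs G) (cut G (X b))"
    "\<And>e. e \<in> arcs G \<Longrightarrow> e \<notin> T \<Longrightarrow> \<exists>t\<in>T. t < e \<and> cut G (X t) e = 1 \<and> (\<forall>t'\<in>T. t' < t \<longrightarrow> cut G (X t') e = 0)"
    using T unfolding fully_optimal_iff[OF G(1) tree X] p_def by auto
  have pA: "p \<in> arcs G" "\<And>e. e \<in> arcs G \<Longrightarrow> p \<le> e" unfolding p_def using G(2) by auto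
  \<comment> \<open>A non-tree edge needs a smaller tree edge in its cycle, which the minimum of all
    edges cannot have.\<close>
  have pT: "p \<in> T"
  proof (rule ccontr)
    assume "p \<notin> T"
    then show False using opt(2)[OF pA(1)] pA(2) TA by force
  qed
  define L where "L = lex_min_tree G"
  have L: "spanning_tree G L" unfolding L_def using lex_min_tree_props(1)[OF G(1) tree] .
  have inL: "f \<in> L" if "f \<in> arcs G" "dif G x f \<noteq> 0" "\<And>e. e \<in> arcs G \<Longrightarrow> e < f \<Longrightarrow> dif G x e = 0" for f x
    unfolding L_def using min_dif_in_lex_min_tree[OF G(1) tree] that by blast
  have pL: "p \<in> L"
    by (rule inL[of _ "\<lambda>v. of_bool (v \<in> X p)"]) (use pA XT(2)[OF pT pT] in force)+
  let ?F = "L - {p}"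
  \<comment> \<open>Passing from all edges to the objective set is harmless: the first nonzero entry
    of row \<open>b\<close> lies in the smallest tree, and it is not at \<open>p\<close>, where the
    row is 0.\<close>
  have first: "first_neg ?F (cut G (X b))" if b: "b \<in> T" "b \<noteq> p" for b
  proof -
    obtain f where f: "f \<in> arcs G" "cut G (X b) f < 0" "\<forall>e\<in>arcs G. e < f \<longrightarrow> cut G (X b) e = 0"
      using opt(1)[OF b] unfolding first_neg_def by blast
    then have "f \<in> L" using inL[of f "\<lambda>v. of_bool (v \<in> X b)"] by force
    moreover have "f \<noteq> p" using f(2) XT(2)[OF b(1) pT] b(2) by auto
    ultimately show ?thesis using f L unfolding first_neg_def spanning_tree_def by blast
  qed
  have "insert p ?F = L" using pL by auto
  moreover have "arcs G = arcs G \<union> ?F" using L unfolding spanning_tree_def by auto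
  ultimately have "alg_inv (\<lambda>t. cut G (X t)) G p (arcs G) ?F T"
    unfolding alg_inv_def
  proof (intro conjI ballI)
    show "\<exists>Y\<subseteq>verts G. \<forall>e\<in>arcs G. cut G Y e = cut G (X t) e" if "t \<in> T" for t
      using XT(1)[OF that] by blast
  qed (use G(1) tree L pT TA p_def XT opt first in auto)
  then have "alg_iter (card ?F) (G, p, arcs G, ?F) = T - {p}" by (rule alg_iter_eq)
  moreover have "card ?F = card L - 1" using pL by simp
  ultimately show ?thesis unfolding alg_output_def Let_def p_def[symmetric] L_def[symmetric] using pT by auto
qed

subsection \<open>Existence of the fully optimal tree\<close>

abbreviation lex_nonpos :: "'e::linorder set \<Rightarrow> ('e \<Rightarrow> int) \<Rightarrow> bool" where
  "lex_nonpos S d \<equiv> (\<forall>e\<in>S. d e = 0) \<or> first_neg S d"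

lemma lex_nonpos_add:
  assumes "lex_nonpos S a" "lex_nonpos S b" "\<And>e. e \<in> S \<Longrightarrow> d e = a e + b e"
  shows "lex_nonpos S d"
proof (cases "first_neg S a \<and> first_neg S b")
  case True
  then show ?thesis using first_neg_add first_neg_cong[of S d "\<lambda>e. a e + b e"] assms(3) by blast
next
  case False
  then show ?thesis
    using assms first_neg_cong[of S d a] first_neg_cong[of S d b] by auto
qed

text \<open>The conclusion is not strict because different elements of \<open>A\<close> may have
  equal vectors on \<open>S\<close>.\<close>

lemma lex_max_exists:
  fixes f :: "'a \<Rightarrow> 'e::linorder \<Rightarrow> int"
  assumes "finite A" "A \<noteq> {}" "finite S"
  obtains m where "m \<in> A" "\<And>x. x \<in> A \<Longrightarrow> lex_nonpos S (\<lambda>e. f x e - f m e)"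
proof -
  let ?R = "\<lambda>x y. first_neg S (\<lambda>e. f x e - f y e)"
  have "asymp_on A ?R"
  proof (rule asymp_onI)
    fix x y assume "?R x y"
    then show "\<not> ?R y x" using first_neg_asym[of S "\<lambda>e. f x e - f y e"] by simp
  qed
  moreover have "transp_on A ?R"
  proof (rule transp_onI)
    fix x y z assume "?R x y" "?R y z"
    then show "?R x z" using first_neg_add[of S "\<lambda>e. f x e - f y e" "\<lambda>e. f y e - f z e"] by simp
  qed
  ultimately obtain m where m: "m \<in> A" "\<forall>x\<in>A. x \<noteq> m \<longrightarrow> \<not> ?R m x"
    using Finite_Set.bex_max_element[OF assms(1) _ _ assms(2), of ?R] by blast
  have "lex_nonpos S (\<lambda>e. f x e - f m e)" if "x \<in> A" for x
    using m(2) that first_neg_trichotomy[OF assms(3), of "\<lambda>e. f x e - f m e"] by (cases "x = m") auto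
  then show ?thesis using that m(1) by blast
qed

lemma cut_union_inter: "cut G (X \<union> Y) e + cut G (X \<inter> Y) e = cut G X e + cut G Y e"
  by (auto simp: dif_def)

lemma cut_compl:
  assumes "wf_digraph G" "e \<in> arcs G"
  shows "cut G (verts G - X) e = - cut G X e"
proof -
  interpret wf_digraph G by fact
  show ?thesis using assms(2) by (auto simp: dif_def)
qed

text \<open>A partial result of the greedy recursion. Edges already chosen form \<open>S\<close>;
  cuts have to vanish on them instead of their being contracted, so that all lexicographic signs
  refer to the arcs of one graph. The alternative to \<open>first_neg\<close> can hold only for the
  smallest edge of \<open>E\<close>, which plays the part of the infinity edge. The condition on all
  \<open>Y\<close> says that only zero cuts avoid \<open>S\<close> and \<open>T\<close>.\<close>

definition lex_tree :: "('v,'e::linorder) pre_digraph \<Rightarrow> 'e set \<Rightarrow> 'e set \<Rightarrow> 'e set \<Rightarrow> ('e \<Rightarrow> 'v set) \<Rightarrow> bool" where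
  "lex_tree G S E T X \<longleftrightarrow>
    T \<subseteq> E \<and>
    (\<forall>t\<in>T. X t \<subseteq> verts G) \<and>
    (\<forall>t\<in>T. \<forall>s\<in>S. cut G (X t) s = 0) \<and>
    (\<forall>t\<in>T. \<forall>t'\<in>T. cut G (X t) t' = of_bool (t = t')) \<and>
    (\<forall>t\<in>T. first_neg (arcs G) (cut G (X t)) \<or> (\<forall>e\<in>E. t \<le> e \<and> cut G (X t) e \<ge> 0)) \<and>
    (\<forall>Y\<subseteq>verts G. (\<forall>s\<in>S \<union> T. cut G Y s = 0) \<longrightarrow> (\<forall>e\<in>arcs G. cut G Y e = 0)) \<and>
    (\<forall>e\<in>E - T. \<exists>t\<in>T. t < e \<and> cut G (X t) e = 1 \<and> (\<forall>t'\<in>T. t' < t \<longrightarrow> cut G (X t') e = 0))"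

lemma lex_treeD:
  assumes "lex_tree G S E T X"
  shows "T \<subseteq> E"
    "\<forall>t\<in>T. X t \<subseteq> verts G"
    "\<forall>t\<in>T. \<forall>s\<in>S. cut G (X t) s = 0"
    "\<forall>t\<in>T. \<forall>t'\<in>T. cut G (X t) t' = of_bool (t = t')"
    "\<forall>t\<in>T. first_neg (arcs G) (cut G (X t)) \<or> (\<forall>e\<in>E. t \<le> e \<and> cut G (X t) e \<ge> 0)"
    "\<forall>Y\<subseteq>verts G. (\<forall>s\<in>S \<union> T. cut G Y s = 0) \<longrightarrow> (\<forall>e\<in>arcs G. cut G Y e = 0)"
    "\<forall>e\<in>E - T. \<exists>t\<in>T. t < e \<and> cut G (X t) e = 1 \<and> (\<forall>t'\<in>T. t' < t \<longrightarrow> cut G (X t') e = 0)"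
  using assms unfolding lex_tree_def by - (elim conjE, assumption)+

text \<open>Take for \<open>C\<close> the lexicographically largest cut that vanishes on \<open>S\<close>, is nonnegative on \<open>E\<close> and
contains \<open>t = Min E\<close>. If \<open>D\<close> vanishes on \<open>S \<union> {t}\<close> and is nonnegative on the part of \<open>E\<close> outside \<open>C\<close>,
then \<open>C + D\<close> is nonnegative on \<open>E\<close> and by modularity splits into two cuts, one not
containing \<open>t\<close> and one competing with \<open>C\<close>; so \<open>D\<close> is negative at its first nonzero entry.\<close>
lemma lex_tree_exists:
  fixes G :: "('v,'e::linorder) pre_digraph"
  assumes G: "fin_digraph G" and "E \<subseteq> arcs G" "S \<subseteq> arcs G"
    and "\<And>Y. Y \<subseteq> verts G \<Longrightarrow> (\<forall>s\<in>S. cut G Y s = 0) \<Longrightarrow> (\<forall>e\<in>E. cut G Y e \<ge> 0) \<Longrightarrow>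
      (\<forall>t\<in>E. (\<forall>e\<in>E. t \<le> e) \<longrightarrow> cut G Y t = 0) \<Longrightarrow> lex_nonpos (arcs G) (cut G Y)"
    and "\<forall>s\<in>S. dif G y s = 0" "\<forall>e\<in>E. dif G y e \<ge> 1"
  shows "\<exists>T X. lex_tree G S E T X"
  using assms(2-)
proof (induction "card E" arbitrary: E S y rule: less_induct)
  case less
  interpret fin_digraph G by (rule G)
  note pos = less.prems(3)
  have finE: "finite E" using less.prems(1) finite_arcs finite_subset by blast
  show ?case
  proof (cases "\<forall>Y\<subseteq>verts G. (\<forall>s\<in>S. cut G Y s = 0) \<longrightarrow> (\<forall>e\<in>arcs G. cut G Y e = 0)")
    case True
    \<comment> \<open>An edge of \<open>E\<close> would yield, by thresholding \<open>y\<close>, a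
      nonzero cut that vanishes on \<open>S\<close>.\<close>
    have "E = {}"
    proof (rule ccontr)
      assume "E \<noteq> {}"
      then obtain e where e: "e \<in> E" "e \<in> arcs G" using less.prems(1) by auto
      then have "dif G y e \<noteq> 0" using less.prems(5) by force
      then obtain Y where "Y \<subseteq> verts G" "e \<in> arcs G \<Longrightarrow> cut G Y e = sgn (dif G y e)"
        "\<And>a. a \<in> arcs G \<Longrightarrow> dif G y a \<ge> 0 \<Longrightarrow> cut G Y a \<ge> 0" "\<And>a. a \<in> arcs G \<Longrightarrow> dif G y a = 0 \<Longrightarrow> cut G Y a = 0"
        by (rule threshold_cut[OF _ wf_digraph]) blast
      then show False using True e \<open>dif G y e \<noteq> 0\<close> less.prems(2,4) by (metis sgn_0_0 subsetD)
    qed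
    then have "lex_tree G S E {} X" for X using True unfolding lex_tree_def by simp
    then show ?thesis by blast
  next
    case False
    then obtain Y0 where Y0: "Y0 \<subseteq> verts G" "\<forall>s\<in>S. cut G Y0 s = 0" "\<exists>e\<in>arcs G. cut G Y0 e \<noteq> 0" by blast
    \<comment> \<open>With \<open>E\<close> empty, the hypothesis would make both \<open>Y0\<close>
      and its complement lexicographically negative, although their cuts are opposite.\<close>
    have "E \<noteq> {}"
    proof
      assume E: "E = {}"
      have compl: "cut G (verts G - Y0) e = - cut G Y0 e" if "e \<in> arcs G" for e
        using cut_compl[OF wf_digraph that] .
      have "lex_nonpos (arcs G) (cut G (verts G - Y0))"
        by (rule pos) (use E Y0 compl less.prems(2) in auto)
      then have "first_neg (arcs G) (\<lambda>e. - cut G Y0 e)"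
        using Y0(3) compl first_neg_cong[of "arcs G" "cut G (verts G - Y0)" "\<lambda>e. - cut G Y0 e"] by auto
      moreover have "first_neg (arcs G) (cut G Y0)" using pos[of Y0] E Y0 by auto
      ultimately show False using first_neg_asym by blast
    qed
    define t where "t = Min E"
    have "t \<in> E" unfolding t_def by (rule Min_in[OF finE \<open>E \<noteq> {}\<close>])
    then have t: "t \<in> E" "\<And>e. e \<in> E \<Longrightarrow> t \<le> e" "t \<in> arcs G"
      using finE less.prems(1) unfolding t_def by auto
    let ?A = "{Y. Y \<subseteq> verts G \<and> (\<forall>s\<in>S. cut G Y s = 0) \<and> (\<forall>e\<in>E. cut G Y e \<ge> 0) \<and> cut G Y t = 1}"
    have yt: "dif G y t \<ge> 1" using less.prems(5) t by blast
    then have "dif G y t \<noteq> 0" by simp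
    then obtain Y1 where "Y1 \<subseteq> verts G" "t \<in> arcs G \<Longrightarrow> cut G Y1 t = sgn (dif G y t)"
      "\<And>a. a \<in> arcs G \<Longrightarrow> dif G y a \<ge> 0 \<Longrightarrow> cut G Y1 a \<ge> 0" "\<And>a. a \<in> arcs G \<Longrightarrow> dif G y a = 0 \<Longrightarrow> cut G Y1 a = 0"
      by (rule threshold_cut[OF _ wf_digraph]) blast
    then have "Y1 \<in> ?A" using yt t less.prems by force
    then have A: "finite ?A" "?A \<noteq> {}" using finite_subset[of ?A "Pow (verts G)"] by auto
    obtain C where C: "C \<in> ?A" and "\<And>Y. Y \<in> ?A \<Longrightarrow> lex_nonpos (arcs G) (\<lambda>e. cut G Y e - cut G C e)"
      using lex_max_exists[OF A finite_arcs, of "cut G"] by blast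
    then have Cmax: "lex_nonpos (arcs G) (\<lambda>e. cut G Y e - cut G C e)"
      if "Y \<subseteq> verts G" "\<forall>s\<in>S. cut G Y s = 0" "\<forall>e\<in>E. cut G Y e \<ge> 0" "cut G Y t = 1" for Y
      using that by simp
    have C: "C \<subseteq> verts G" "\<And>s. s \<in> S \<Longrightarrow> cut G C s = 0" "\<And>e. e \<in> E \<Longrightarrow> cut G C e \<ge> 0" "cut G C t = 1"
      using C by auto
    define E' where "E' = {e\<in>E. cut G C e = 0}"
    have tE': "t \<notin> E'" using C(4) unfolding E'_def by simp
    have pos': "lex_nonpos (arcs G) (cut G D)"
      if D: "D \<subseteq> verts G" "\<forall>s\<in>insert t S. cut G D s = 0" "\<forall>e\<in>E'. cut G D e \<ge> 0" for D
    proof -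
      have split: "lex_nonpos (arcs G) (cut G D)"
        if U: "U \<subseteq> verts G" "\<forall>s\<in>S. cut G U s = 0" "\<forall>e\<in>E. cut G U e \<ge> 0" "cut G U t = 0"
          and W: "W \<subseteq> verts G" "\<forall>s\<in>S. cut G W s = 0" "\<forall>e\<in>E. cut G W e \<ge> 0"
          and sum: "\<And>e. cut G U e + cut G W e = cut G C e + cut G D e" for U W
      proof (rule lex_nonpos_add)
        show "lex_nonpos (arcs G) (cut G U)"
        proof (rule pos[OF U(1-3)])
          show "\<forall>a\<in>E. (\<forall>e\<in>E. a \<le> e) \<longrightarrow> cut G U a = 0" using U(4) t(1,2) by (metis order.antisym)
        qed
        have "cut G W t = 1" using sum[of t] U(4) C(4) D(2) by simp
        then show "lex_nonpos (arcs G) (\<lambda>e. cut G W e - cut G C e)" using Cmax W by blast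
        show "cut G D e = cut G U e + (cut G W e - cut G C e)" for e using sum[of e] by simp
      qed
      have "cut G (C \<union> D) s = 0 \<and> cut G (C \<inter> D) s = 0" if "s \<in> S" for s
      proof -
        have "cut G C s = 0" "cut G D s = 0" using C D that by auto
        then show ?thesis by (auto simp: dif_def split: if_splits)
      qed
      then have U0: "\<forall>s\<in>S. cut G (C \<union> D) s = 0" "\<forall>s\<in>S. cut G (C \<inter> D) s = 0" by blast+
      have U1: "cut G (C \<union> D) e \<ge> 0 \<and> cut G (C \<inter> D) e \<ge> 0" if "e \<in> E" for e
      \<comment> \<open>On an edge leaving \<open>C\<close>, the union contains the tail and the
        intersection misses the head, so neither is entered, whatever \<open>D\<close> does
        there.\<close>
      proof (cases "cut G C e = 0")
        case True
        then have "cut G D e \<ge> 0" using D(3) that unfolding E'_def by simp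
        with True show ?thesis by (auto simp: dif_def split: if_splits)
      next
        case False
        then have "cut G C e = 1" using C(3)[OF that] cut_cases[of G C e] by auto
        then have "tail G e \<in> C" "head G e \<notin> C"
          by (cases "tail G e \<in> C"; cases "head G e \<in> C"; simp add: dif_def)+
        then show ?thesis by (simp add: dif_def)
      qed
      have sub: "C \<union> D \<subseteq> verts G" "C \<inter> D \<subseteq> verts G" using C(1) D(1) by auto
      have "cut G D t = 0" using D(2) by simp
      then consider "cut G (C \<union> D) t = 0" | "cut G (C \<inter> D) t = 0"
        using C(4) U1[OF t(1)] cut_union_inter[of G C D t] by linarith
      then show ?thesis
      proof cases
        case 1
        then show ?thesis using split[of "C \<union> D" "C \<inter> D"] sub U0 U1 cut_union_inter[of G C D] by blast
      next
        case 2
        then show ?thesis using split[of "C \<inter> D" "C \<union> D"] sub U0 U1 cut_union_inter[of G C D]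
          by (simp add: add.commute)
      qed
    qed
    \<comment> \<open>The correction makes the coboundary vanish at \<open>t\<close>; it changes
      nothing on \<open>E'\<close> or \<open>S\<close>, where the cut of \<open>C\<close> is
      0.\<close>
    let ?y = "\<lambda>v. y v - dif G y t * of_bool (v \<in> C)"
    have dify: "dif G ?y e = dif G y e - dif G y t * cut G C e" for e
      unfolding dif_diff dif_scale ..
    have "\<exists>T X. lex_tree G (insert t S) E' T X"
    proof (rule less.hyps)
      show "card E' < card E" using t tE' finE by (intro psubset_card_mono) (auto simp: E'_def)
      show "E' \<subseteq> arcs G" using less.prems(1) by (auto simp: E'_def)
      show "\<forall>s\<in>insert t S. dif G ?y s = 0" unfolding dify using C less.prems(4) by auto
      show "\<forall>e\<in>E'. dif G ?y e \<ge> 1" unfolding dify E'_def using less.prems(5) by auto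
    qed (use t less.prems(2) pos' in auto)
    then obtain T X where TX: "lex_tree G (insert t S) E' T X" by blast
    let ?X = "X(t := C)"
    note TE' = lex_treeD(1)[OF TX] and X = lex_treeD(2-5)[OF TX, rule_format]
      and full = lex_treeD(6)[OF TX] and dual = lex_treeD(7)[OF TX, rule_format]
    have tT: "t \<notin> T" using TE' tE' by auto
    \<comment> \<open>Below the top level no exception for the smallest edge remains:
      \<open>pos'\<close> also covers cuts containing it, and row \<open>a\<close> is not zero
      because its entry at \<open>a\<close> is 1.\<close>
    have neg: "first_neg (arcs G) (cut G (X a))" if a: "a \<in> T" for a
    proof (rule ccontr)
      assume n: "\<not> ?thesis"
      then have "\<forall>e\<in>E'. cut G (X a) e \<ge> 0" using lex_treeD(5)[OF TX] a by blast
      moreover have "\<forall>s\<in>insert t S. cut G (X a) s = 0" using lex_treeD(3)[OF TX] a by blast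
      ultimately have "\<forall>e\<in>arcs G. cut G (X a) e = 0" using pos'[of "X a"] X(1)[OF a] n by blast
      moreover have "a \<in> arcs G" using a TE' less.prems(1) unfolding E'_def by auto
      ultimately show False using X(3)[OF a a] by simp
    qed
    have "lex_tree G S E (insert t T) ?X" unfolding lex_tree_def
    proof (intro conjI ballI)
      show "insert t T \<subseteq> E" using t TE' unfolding E'_def by auto
      show "?X a \<subseteq> verts G" if "a \<in> insert t T" for a using that X(1) C(1) by auto
      show "cut G (?X a) s = 0" if "a \<in> insert t T" "s \<in> S" for a s using that X(2) C(2) by auto
      show "cut G (?X a) b = of_bool (a = b)" if a: "a \<in> insert t T" and b: "b \<in> insert t T" for a b
      proof (cases "a = t")
        case True
        then show ?thesis using b TE' C(4) tT unfolding E'_def by auto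
      next
        case False
        then show ?thesis using a b X(2,3) by auto
      qed
      show "first_neg (arcs G) (cut G (?X a)) \<or> (\<forall>e\<in>E. a \<le> e \<and> cut G (?X a) e \<ge> 0)" if "a \<in> insert t T" for a
      proof (cases "a = t")
        case True
        then show ?thesis using t(2) C(3) by simp
      next
        case False
        then show ?thesis using that neg[of a] by simp
      qed
    next
      show "\<forall>Y\<subseteq>verts G. (\<forall>s\<in>S \<union> insert t T. cut G Y s = 0) \<longrightarrow> (\<forall>e\<in>arcs G. cut G Y e = 0)" 
        using full by (simp only: Un_insert_left Un_insert_right)
    next
      fix e assume e: "e \<in> E - insert t T"
      show "\<exists>a\<in>insert t T. a < e \<and> cut G (?X a) e = 1 \<and> (\<forall>t'\<in>insert t T. t' < a \<longrightarrow> cut G (?X t') e = 0)"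
      proof (cases "cut G C e = 0")
        case True
        then obtain a where a: "a \<in> T" "a < e" "cut G (X a) e = 1" "\<forall>t'\<in>T. t' < a \<longrightarrow> cut G (X t') e = 0"
          using dual[of e] e unfolding E'_def by auto
        then show ?thesis using True tT by (intro bexI[of _ a]) auto
      next
        case False
        then have "cut G C e = 1" using C(3)[of e] e cut_cases[of G C e] by auto
        moreover have "t < e" using t(2)[of e] e by (auto simp: order.order_iff_strict)
        moreover have "\<not> t' < t" if "t' \<in> insert t T" for t' using that t(2)[of t'] TE' unfolding E'_def by auto
        ultimately show ?thesis by (intro bexI[of _ t]) auto
      qed
    qed
    then show ?thesis by blast
  qed
qed

text \<open>In a nonempty directed cut, a vertex of \<open>Y\<close> of highest potential is a
  source and a vertex outside of lowest potential is a sink. These are the ends of \<open>p\<close>,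
  so \<open>p\<close> crosses. This supplies the sign hypothesis of \<open>lex_tree_exists\<close>
  at the top level.\<close>

lemma bipolar_cut:
  assumes G: "fin_digraph G" "bipolar G p"
    and Y: "Y \<subseteq> verts G" "\<forall>e\<in>arcs G. cut G Y e \<ge> 0" "cut G Y p = 0"
  shows "\<forall>e\<in>arcs G. cut G Y e = 0"
proof (rule ccontr)
  interpret fin_digraph G by fact
  assume "\<not> ?thesis"
  then obtain e where e: "e \<in> arcs G" "cut G Y e \<noteq> 0" by blast
  then have "tail G e \<in> Y \<longleftrightarrow> head G e \<notin> Y" by (auto simp: dif_def)
  then have ne: "Y \<noteq> {}" "verts G - Y \<noteq> {}" using tail_in_verts[OF e(1)] head_in_verts[OF e(1)] by blast+
  have fin: "finite Y" "finite (verts G - Y)" using Y(1) finite_subset by fastforce+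
  obtain s t where st: "{v. is_source G v} = {s}" "{v. is_sink G v} = {t}" "{s, t} = {tail G p, head G p}"
    and p: "p \<in> arcs G" "acyclic_digraph G" using G(2) unfolding bipolar_def by blast
  obtain y where y: "\<And>e. e \<in> arcs G \<Longrightarrow> dif G y e \<ge> 1" by (rule acyclic_potential[OF G(1) p(2)]) blast
  obtain v where v: "v \<in> Y" "\<And>w. w \<in> Y \<Longrightarrow> y w \<le> y v"
    using arg_min_if_finite[OF fin(1) ne(1), of "\<lambda>v. - y v"] by (auto simp: not_less)
  have "is_source G v" unfolding is_source_def
  proof
    show "v \<in> verts G" using v Y by auto
    show "in_arcs G v = {}"
    proof (rule ccontr)
      assume "in_arcs G v \<noteq> {}"
      then obtain e where "e \<in> in_arcs G v" by blast
      then have e: "e \<in> arcs G" "head G e = v" by auto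
      then have "tail G e \<in> Y" using Y(2) v(1) by (force simp: dif_def)
      then show False using v(2)[of "tail G e"] y[OF e(1)] e(2) by (simp add: dif_def)
    qed
  qed
  then have s: "s \<in> Y" using st(1) v(1) by auto
  obtain w where w: "w \<in> verts G - Y" "\<And>u. u \<in> verts G - Y \<Longrightarrow> y w \<le> y u"
    using arg_min_if_finite[OF fin(2) ne(2), of y] by (meson not_less)
  have "is_sink G w" unfolding is_sink_def
  proof
    show "w \<in> verts G" using w by auto
    show "out_arcs G w = {}"
    proof (rule ccontr)
      assume "out_arcs G w \<noteq> {}"
      then obtain e where "e \<in> out_arcs G w" by blast
      then have e: "e \<in> arcs G" "tail G e = w" by auto
      then have "head G e \<in> verts G - Y" using Y(2) w(1) by (force simp: dif_def)
      then show False using w(2)[of "head G e"] y[OF e(1)] e(2) by (simp add: dif_def)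
    qed
  qed
  then have t: "t \<notin> Y" using st(2) w(1) by auto
  show False using st(3) s t Y(3) by (auto simp: dif_def doubleton_eq_iff)
qed

lemma fully_optimal_exists:
  fixes G :: "('v,'e::linorder) pre_digraph"
  assumes G: "fin_digraph G" "connected_digraph G" and p: "bipolar G (Min (arcs G))"
  obtains T where "fully_optimal G T"
proof -
  interpret fin_digraph G by fact
  have conn: "connected_by G (arcs G)" using G(2) by (simp add: connected_digraph_def)
  let ?p = "Min (arcs G)"
  have pA: "?p \<in> arcs G" "\<And>e. e \<in> arcs G \<Longrightarrow> ?p \<le> e" and ac: "acyclic_digraph G"
    using p by (auto simp: bipolar_def)
  obtain y where y: "\<And>e. e \<in> arcs G \<Longrightarrow> dif G y e \<ge> 1" by (rule acyclic_potential[OF G(1) ac]) blast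
  have "\<exists>T X. lex_tree G {} (arcs G) T X"
  proof (rule lex_tree_exists[OF G(1), where y = y])
    fix Y assume Y: "Y \<subseteq> verts G" "\<forall>e\<in>arcs G. cut G Y e \<ge> 0"
      "\<forall>t\<in>arcs G. (\<forall>e\<in>arcs G. t \<le> e) \<longrightarrow> cut G Y t = 0"
    then have "cut G Y ?p = 0" using pA by blast
    then show "lex_nonpos (arcs G) (cut G Y)" using bipolar_cut[OF G(1) p Y(1,2)] by blast
  qed (use y in auto)
  then obtain T X where TX: "lex_tree G {} (arcs G) T X" by blast
  note TA = lex_treeD(1)[OF TX] and X = lex_treeD(2,4)[OF TX, rule_format] and dual = lex_treeD(7)[OF TX]
  have neg: "first_neg (arcs G) (cut G (X t)) \<or> (\<forall>e\<in>arcs G. t \<le> e)" if "t \<in> T" for t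
    using lex_treeD(5)[OF TX] that by blast
  have full: "\<forall>e\<in>arcs G. cut G Y e = 0" if "Y \<subseteq> verts G" "\<forall>s\<in>T. cut G Y s = 0" for Y
    using lex_treeD(6)[OF TX] that by simp
  have dc: "dual_cuts G T X" using X unfolding dual_cuts_def by blast
  have tree: "spanning_tree G T"
  proof (rule spanning_treeI[OF TA])
    show "connected_by G T"
    proof (rule connected_byI[OF wf_digraph])
      fix x :: "'v \<Rightarrow> int" and u v
      assume x: "\<And>e. e \<in> T \<inter> arcs G \<Longrightarrow> dif G x e = 0" and uv: "u \<in> verts G" "v \<in> verts G"
      have "dif G x e = 0" if e: "e \<in> arcs G" for e
      proof (rule ccontr)
        assume ne: "dif G x e \<noteq> 0"
        then obtain Y where Y: "Y \<subseteq> verts G" "e \<in> arcs G \<Longrightarrow> cut G Y e = sgn (dif G x e)"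
          "\<And>a. a \<in> arcs G \<Longrightarrow> dif G x a \<ge> 0 \<Longrightarrow> cut G Y a \<ge> 0" "\<And>a. a \<in> arcs G \<Longrightarrow> dif G x a = 0 \<Longrightarrow> cut G Y a = 0"
          by (rule threshold_cut[OF _ wf_digraph]) blast
        \<comment> \<open>The closing condition of \<open>lex_tree\<close> speaks of cuts only;
          thresholding extends it to potentials.\<close>
        have "\<forall>s\<in>T. cut G Y s = 0" using Y(4) x TA by auto
        then have "cut G Y e = 0" using full[OF Y(1)] e by blast
        then show False using Y(2)[OF e] ne by (simp add: sgn_0_0)
      qed
      then show "x u = x v" using connected_by_const[OF conn] uv by blast
    qed
    show "\<exists>x. dif G x t \<noteq> 0 \<and> (\<forall>t'\<in>T - {t}. dif G x t' = 0)" if "t \<in> T" for t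
      using that X(2) by (intro exI[of _ "\<lambda>v. of_bool (v \<in> X t)"]) auto
  qed
  have "first_neg (arcs G) (cut G (X b))" if b: "b \<in> T - {?p}" for b
  proof -
    have "b \<noteq> ?p" "?p \<le> b" using b TA pA(2) by blast+
    then have "\<not> b \<le> ?p" by (metis order.antisym)
    then show ?thesis using neg[of b] b pA(1) by blast
  qed
  then have "fully_optimal G T" unfolding fully_optimal_iff[OF G(1) tree dc] using dual by blast
  then show ?thesis using that by blast
qed

theorem theorem4p3:
  fixes G :: "('v, 'e::linorder) pre_digraph"
  assumes "fin_digraph G"
    and "connected_digraph G"
    and "arcs G \<noteq> {}"
    and "bipolar G (Min (arcs G))"
  shows "alg_output G = alpha G"
proof -
  obtain T where T: "fully_optimal G T" using fully_optimal_exists[OF assms(1,2,4)] .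
  have "alg_output G = T'" if "fully_optimal G T'" for T'
    using alg_output_eq_fully_optimal[OF assms(1,3) that] .
  then show ?thesis unfolding alpha_def using T by (metis the_equality)
qed

end
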